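(* Let $M$ be a Riemannian manifold of dimension $n$ with metric tensor $\omega=\langle\ ,\ \rangle$, written in a coordinate chart $(x,U)$ as $\omega=\sum_{p,q=1}^n g_{pq}\,dx^p\otimes dx^q$ with $g_{pq}=g_{qp}$, and let $\nabla$ be the Levi-Civita connection, with which $\omega$ is compatible. Let $d\omega$ be the Leibniz coboundary of $\omega$. Then: (i) on $U$, for all $i,\ell,j\in\{1,\ldots,n\}$, $$d\omega\Big(\frac{\partial}{\partial x^i}\otimes\frac{\partial}{\partial x^\ell}\otimes\frac{\partial}{\partial x^j}\Big)=2[ij,\ell]$$ (twice the Christoffel symbol of the first kind); (ii) $d\omega(X\otimes Y\otimes Z)=2\langle Y,\nabla_X Z\rangle$ for all $X,Y,Z\in\chi(M)$.
   Context: $\chi(M)$ is the Lie algebra of $C^\infty$ vector fields on $M$. For a two-tensor $\omega$ on $M$ (a $C^\infty$ section of $T^*(M)\otimes T^*(M)$), regarded as a map $\chi(M)^{\otimes 2}\to C^\infty(M)$, $\omega(X\otimes Y)(p)=\omega(X(p)\otimes Y(p))$, the Leibniz coboundary $d\omega:\chi(M)^{\otimes 3}\to C^\infty(M)$ (tensor products over $\mathbf{R}$) is $$d\omega(X\otimes Y\otimes Z)=X(\omega(Y\otimes Z))-Y(\omega(X\otimes Z))+Z(\omega(X\otimes Y))-\omega([X,Y]\otimes Z)+\omega([X,Z]\otimes Y)+\omega(X\otimes[Y,Z]).$$ The value of $d\omega(X\otimes Y\otimes Z)$ at a point depends only on $X,Y,Z$ near that point, so $d\omega$ can be evaluated at $p\in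 U$ on vector fields defined only on $U$ by replacing them with global vector fields agreeing with them near $p$. The Christoffel symbols of the first kind are $$[ij,\ell]=\frac12\Big(\frac{\partial g_{j\ell}}{\partial x^i}+\frac{\partial g_{i\ell}}{\partial x^j}-\frac{\partial g_{ij}}{\partial x^\ell}\Big).$$ *)

theory Defs
  imports "HOL-Analysis.Analysis"
begin

section \<open>Smooth functions on open subsets of Euclidean space\<close>

definition partial_deriv :: "'n::finite \<Rightarrow> (real^'n \<Rightarrow> real) \<Rightarrow> real^'n \<Rightarrow> real" where
  "partial_deriv i f a = frechet_derivative f (at a) (axis i 1)"

primrec Ck_on :: "nat \<Rightarrow> (real^'n::finite \<Rightarrow> real) \<Rightarrow> (real^'n) set \<Rightarrow> bool" where
  "Ck_on 0 f S \<longleftrightarrow> continuous_on S f"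
| "Ck_on (Suc k) f S \<longleftrightarrow> f differentiable_on S \<and> (\<forall>i. Ck_on k (partial_deriv i f) S)"

text \<open>Only used on open sets \<open>S\<close>.\<close>

definition C_infinity_on :: "(real^'n::finite \<Rightarrow> real) \<Rightarrow> (real^'n) set \<Rightarrow> bool" where
  "C_infinity_on f S \<longleftrightarrow> (\<forall>k. Ck_on k f S)"


section \<open>Smooth manifolds\<close>

text \<open>
  The manifold is the whole type \<open>'a\<close>, its dimension is \<open>n = CARD('n)\<close>, and the elements of \<open>'n\<close>
  play the role of the indices \<open>1, \<dots>, n\<close>. A chart \<open>(x, U)\<close> is a total function \<open>x\<close> of which only
  the values on \<open>U\<close> matter. The manifold is Hausdorff; second countability or paracompactness is
  not required, so that every convention on this point is covered.
\<close>

type_synonym ('a, 'n) chart = "('a \<Rightarrow> real^'n) \<times> 'a set"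

definition topological_chart :: "('a::t2_space, 'n::finite) chart \<Rightarrow> bool" where
  "topological_chart c \<longleftrightarrow> (case c of (x, U) \<Rightarrow>
     open U \<and> open (x ` U) \<and> homeomorphism U (x ` U) x (inv_into U x))"

definition smooth_transition :: "('a, 'n::finite) chart \<Rightarrow> ('a, 'n) chart \<Rightarrow> bool" where
  "smooth_transition c d \<longleftrightarrow> (case (c, d) of ((x, U), (y, V)) \<Rightarrow>
     (\<forall>i. C_infinity_on (\<lambda>a. y (inv_into U x a) $ i) (x ` (U \<inter> V))))"

definition smooth_atlas :: "('a::t2_space, 'n::finite) chart set \<Rightarrow> bool" where
  "smooth_atlas A \<longleftrightarrow>
     (\<forall>c\<in>A. topological_chart c) \<and> (\<Union>(x, U)\<in>A. U) = UNIV \<and>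
     (\<forall>c\<in>A. \<forall>d\<in>A. smooth_transition c d)"

text \<open>The coordinate charts are those of the maximal atlas containing \<open>A\<close>.\<close>

definition charts :: "('a::t2_space, 'n::finite) chart set \<Rightarrow> ('a, 'n) chart set" where
  "charts A = {c. topological_chart c \<and>
     (\<forall>d\<in>A. smooth_transition c d \<and> smooth_transition d c)}"

definition smooth_fun_on ::
    "('a::t2_space, 'n::finite) chart set \<Rightarrow> 'a set \<Rightarrow> ('a \<Rightarrow> real) \<Rightarrow> bool" where
  "smooth_fun_on A W f \<longleftrightarrow> open W \<and>
     (\<forall>(x, U)\<in>A. C_infinity_on (\<lambda>a. f (inv_into U x a)) (x ` (U \<inter> W)))"

definition smooth_near :: "('a::t2_space, 'n::finite) chart set \<Rightarrow> 'a \<Rightarrow> ('a \<Rightarrow> real) \<Rightarrow> bool" where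
  "smooth_near A p f \<longleftrightarrow> (\<exists>W. p \<in> W \<and> smooth_fun_on A W f)"


section \<open>Tangent vectors and vector fields\<close>

text \<open>
  Tangent vectors at \<open>p\<close> are the derivations at \<open>p\<close> of the algebra of germs of smooth functions at
  \<open>p\<close>. They are encoded as functionals on all functions, with the dummy value \<open>0\<close> on functions that
  are not smooth near \<open>p\<close>, so that equality of tangent vectors is equality in HOL.
\<close>

type_synonym 'a tangent = "('a \<Rightarrow> real) \<Rightarrow> real"
type_synonym 'a vfield = "'a \<Rightarrow> 'a tangent"

definition tangent_space :: "('a::t2_space, 'n::finite) chart set \<Rightarrow> 'a \<Rightarrow> 'a tangent set" where
  "tangent_space A p = {v.
     (\<forall>f g. smooth_near A p f \<longrightarrow> smooth_near A p g \<longrightarrow>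
        (eventually (\<lambda>q. f q = g q) (nhds p) \<longrightarrow> v f = v g) \<and>
        v (\<lambda>q. f q + g q) = v f + v g \<and>
        v (\<lambda>q. f q * g q) = v f * g p + f p * v g) \<and>
     (\<forall>c f. smooth_near A p f \<longrightarrow> v (\<lambda>q. c * f q) = c * v f) \<and>
     (\<forall>f. \<not> smooth_near A p f \<longrightarrow> v f = 0)}"

definition vector_fields :: "('a::t2_space, 'n::finite) chart set \<Rightarrow> 'a vfield set" where
  "vector_fields A = {X. (\<forall>p. X p \<in> tangent_space A p) \<and>
     (\<forall>W f. smooth_fun_on A W f \<longrightarrow> smooth_fun_on A W (\<lambda>p. X p f))}"

definition lie_bracket ::
    "('a::t2_space, 'n::finite) chart set \<Rightarrow> 'a vfield \<Rightarrow> 'a vfield \<Rightarrow> 'a vfield" where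
  "lie_bracket A X Y = (\<lambda>p f.
     if smooth_near A p f then X p (\<lambda>q. Y q f) - Y p (\<lambda>q. X q f) else 0)"

definition chart_partial ::
    "('a, 'n::finite) chart \<Rightarrow> 'n \<Rightarrow> ('a \<Rightarrow> real) \<Rightarrow> 'a \<Rightarrow> real" where
  "chart_partial c i f p = (case c of (x, U) \<Rightarrow>
     partial_deriv i (\<lambda>a. f (inv_into U x a)) (x p))"

text \<open>The field \<open>\<partial>/\<partial>x\<^sup>i\<close>, meaningful at the points of the chart domain only.\<close>

definition coord_field ::
    "('a::t2_space, 'n::finite) chart set \<Rightarrow> ('a, 'n) chart \<Rightarrow> 'n \<Rightarrow> 'a vfield" where
  "coord_field A c i = (\<lambda>p f. if smooth_near A p f then chart_partial c i f p else 0)"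


section \<open>Two-tensors and Riemannian metrics\<close>

text \<open>
  The tensor \<open>\<omega>\<close> is given by its values \<open>\<omega> p u v\<close> on \<open>u \<otimes> v\<close> for tangent vectors \<open>u, v\<close> at \<open>p\<close>; maps
  on tensor products are written as functions of several arguments throughout.
\<close>

type_synonym 'a tensor2 = "'a \<Rightarrow> 'a tangent \<Rightarrow> 'a tangent \<Rightarrow> real"

definition smooth_two_tensor ::
    "('a::t2_space, 'n::finite) chart set \<Rightarrow> 'a tensor2 \<Rightarrow> bool" where
  "smooth_two_tensor A \<omega> \<longleftrightarrow>
     (\<forall>p. \<forall>u\<in>tangent_space A p. \<forall>v\<in>tangent_space A p. \<forall>w\<in>tangent_space A p. \<forall>a b.
        \<omega> p (\<lambda>f. a * u f + b * v f) w = a * \<omega> p u w + b * \<omega> p v w \<and>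
        \<omega> p w (\<lambda>f. a * u f + b * v f) = a * \<omega> p w u + b * \<omega> p w v) \<and>
     (\<forall>(x, U)\<in>A. \<forall>i j. smooth_fun_on A U
        (\<lambda>p. \<omega> p (coord_field A (x, U) i p) (coord_field A (x, U) j p)))"

definition riemannian_metric ::
    "('a::t2_space, 'n::finite) chart set \<Rightarrow> 'a tensor2 \<Rightarrow> bool" where
  "riemannian_metric A \<omega> \<longleftrightarrow> smooth_two_tensor A \<omega> \<and>
     (\<forall>p. \<forall>u\<in>tangent_space A p. \<forall>v\<in>tangent_space A p.
        \<omega> p u v = \<omega> p v u \<and> (u \<noteq> (\<lambda>f. 0) \<longrightarrow> \<omega> p u u > 0))"

definition tensor_app :: "'a tensor2 \<Rightarrow> 'a vfield \<Rightarrow> 'a vfield \<Rightarrow> 'a \<Rightarrow> real" where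
  "tensor_app \<omega> X Y = (\<lambda>p. \<omega> p (X p) (Y p))"

text \<open>Since \<open>dx\<^sup>a(u) = u(x\<^sup>a)\<close>, this says \<open>\<omega> = \<Sum>g\<^sub>a\<^sub>b dx\<^sup>a \<otimes> dx\<^sup>b\<close> on the chart domain.\<close>

definition has_components ::
    "('a::t2_space, 'n::finite) chart set \<Rightarrow> 'a tensor2 \<Rightarrow> ('a, 'n) chart \<Rightarrow>
     ('n \<Rightarrow> 'n \<Rightarrow> 'a \<Rightarrow> real) \<Rightarrow> bool" where
  "has_components A \<omega> c g \<longleftrightarrow> (case c of (x, U) \<Rightarrow>
     (\<forall>p\<in>U. \<forall>u\<in>tangent_space A p. \<forall>v\<in>tangent_space A p.
        \<omega> p u v = (\<Sum>a\<in>UNIV. \<Sum>b\<in>UNIV. g a b p * u (\<lambda>q. x q $ a) * v (\<lambda>q. x q $ b))))"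

text \<open>\<open>christoffel_first c g i j l\<close> is \<open>[ij,l]\<close>.\<close>

definition christoffel_first ::
    "('a, 'n::finite) chart \<Rightarrow> ('n \<Rightarrow> 'n \<Rightarrow> 'a \<Rightarrow> real) \<Rightarrow> 'n \<Rightarrow> 'n \<Rightarrow> 'n \<Rightarrow> 'a \<Rightarrow> real" where
  "christoffel_first c g i j l p =
     1/2 * (chart_partial c i (g j l) p + chart_partial c j (g i l) p
            - chart_partial c l (g i j) p)"


section \<open>The Leibniz coboundary\<close>

definition leibniz_d ::
    "('a::t2_space, 'n::finite) chart set \<Rightarrow> 'a tensor2 \<Rightarrow>
     'a vfield \<Rightarrow> 'a vfield \<Rightarrow> 'a vfield \<Rightarrow> 'a \<Rightarrow> real" where
  "leibniz_d A \<omega> X Y Z = (\<lambda>p.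
       X p (tensor_app \<omega> Y Z) - Y p (tensor_app \<omega> X Z) + Z p (tensor_app \<omega> X Y)
     - tensor_app \<omega> (lie_bracket A X Y) Z p
     + tensor_app \<omega> (lie_bracket A X Z) Y p
     + tensor_app \<omega> X (lie_bracket A Y Z) p)"

text \<open>
  The value at \<open>p\<close> on vector fields defined only near \<open>p\<close>, obtained by replacing them with global
  vector fields that agree with them near \<open>p\<close>.
\<close>

definition leibniz_d_local ::
    "('a::t2_space, 'n::finite) chart set \<Rightarrow> 'a tensor2 \<Rightarrow>
     'a vfield \<Rightarrow> 'a vfield \<Rightarrow> 'a vfield \<Rightarrow> 'a \<Rightarrow> real" where
  "leibniz_d_local A \<omega> X Y Z p = (THE c. \<exists>X'\<in>vector_fields A. \<exists>Y'\<in>vector_fields A. \<exists>Z'\<in>vector_fields A.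
     eventually (\<lambda>q. X' q = X q \<and> Y' q = Y q \<and> Z' q = Z q) (nhds p) \<and>
     c = leibniz_d A \<omega> X' Y' Z' p)"


section \<open>The Levi-Civita connection\<close>

definition affine_connection ::
    "('a::t2_space, 'n::finite) chart set \<Rightarrow> ('a vfield \<Rightarrow> 'a vfield \<Rightarrow> 'a vfield) \<Rightarrow> bool" where
  "affine_connection A D \<longleftrightarrow>
     (\<forall>X\<in>vector_fields A. \<forall>Y\<in>vector_fields A. D X Y \<in> vector_fields A) \<and>
     (\<forall>X\<in>vector_fields A. \<forall>Y\<in>vector_fields A. \<forall>Z\<in>vector_fields A.
        D (\<lambda>p f. X p f + Y p f) Z = (\<lambda>p f. D X Z p f + D Y Z p f) \<and>
        D X (\<lambda>p f. Y p f + Z p f) = (\<lambda>p f. D X Y p f + D X Z p f)) \<and>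
     (\<forall>X\<in>vector_fields A. \<forall>Y\<in>vector_fields A. \<forall>h. smooth_fun_on A UNIV h \<longrightarrow>
        D (\<lambda>p f. h p * X p f) Y = (\<lambda>p f. h p * D X Y p f) \<and>
        D X (\<lambda>p f. h p * Y p f) = (\<lambda>p f. X p h * Y p f + h p * D X Y p f))"

definition metric_compatible ::
    "('a::t2_space, 'n::finite) chart set \<Rightarrow> 'a tensor2 \<Rightarrow>
     ('a vfield \<Rightarrow> 'a vfield \<Rightarrow> 'a vfield) \<Rightarrow> bool" where
  "metric_compatible A \<omega> D \<longleftrightarrow>
     (\<forall>X\<in>vector_fields A. \<forall>Y\<in>vector_fields A. \<forall>Z\<in>vector_fields A. \<forall>p.
        X p (tensor_app \<omega> Y Z) = tensor_app \<omega> (D X Y) Z p + tensor_app \<omega> Y (D X Z) p)"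

definition torsion_free ::
    "('a::t2_space, 'n::finite) chart set \<Rightarrow> ('a vfield \<Rightarrow> 'a vfield \<Rightarrow> 'a vfield) \<Rightarrow> bool" where
  "torsion_free A D \<longleftrightarrow>
     (\<forall>X\<in>vector_fields A. \<forall>Y\<in>vector_fields A.
        (\<lambda>p f. D X Y p f - D Y X p f) = lie_bracket A X Y)"

definition levi_civita_connection ::
    "('a::t2_space, 'n::finite) chart set \<Rightarrow> 'a tensor2 \<Rightarrow>
     ('a vfield \<Rightarrow> 'a vfield \<Rightarrow> 'a vfield) \<Rightarrow> bool" where
  "levi_civita_connection A \<omega> D \<longleftrightarrow>
     affine_connection A D \<and> metric_compatible A \<omega> D \<and> torsion_free A D"

end

theory Submission
  imports Defs
begin

text \<open>
  Part (i): brackets of coordinate fields vanish because second partial derivatives commute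
  (\<open>lie_bracket_coord_fields\<close>), and \<open>\<omega>(\<partial>\<^sub>j \<otimes> \<partial>\<^sub>k) = g\<^sub>j\<^sub>k\<close>, so that only
  \<open>\<partial>\<^sub>i g\<^sub>l\<^sub>j - \<partial>\<^sub>l g\<^sub>i\<^sub>j + \<partial>\<^sub>j g\<^sub>i\<^sub>l\<close> remains of \<open>d\<omega>(\<partial>\<^sub>i \<otimes> \<partial>\<^sub>l \<otimes> \<partial>\<^sub>j)\<close>; by the
  symmetry of \<open>g\<close> this is \<open>2[ij,l]\<close>. The computation involves the fields near the point only, hence it
  gives the same value for every choice of global vector fields that agree there with the
  coordinate fields (\<open>leibniz_d_coord_fields\<close>). This is the uniqueness half of the evaluation of
  \<open>d\<omega>\<close> on local fields. The existence half is that such global fields exist, by cutting off with a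
  smooth bump function (\<open>coord_field_extension\<close>).

  Part (ii) is a Koszul-type computation. Metric compatibility replaces each of the three
  derivatives in \<open>d\<omega>(X \<otimes> Y \<otimes> Z)\<close> by two covariant terms, and vanishing torsion writes each bracket
  as a difference of two. Of the resulting twelve terms ten cancel in pairs, and the other two
  are both equal to \<open>\<langle>Y, \<nabla>\<^sub>X Z\<rangle>\<close> (\<open>leibniz_d_levi_civita\<close>).

  Two points need care. First, tangent vectors are functionals that vanish on functions which are not
  smooth, so the components \<open>g\<^sub>j\<^sub>k\<close> must be shown to be smooth in every chart of the maximal atlas,
  while smoothness of the tensor is stated in the charts of the given atlas. The change of basis
  \<open>\<partial>/\<partial>x\<^sup>i = \<Sum>\<^sub>b (\<partial>y\<^sup>b/\<partial>x\<^sup>i) \<partial>/\<partial>y\<^sup>b\<close>, which is just the chain rule, settles this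
  (\<open>tensor_components_smooth\<close>). Second, the analysis on \<open>\<real>\<^sup>n\<close> underneath has to be developed for the
  iterated partial derivatives that define smoothness: closure properties, the chain rule,
  symmetry of second derivatives (\<open>mixed_partials_commute\<close>) and a bump function (\<open>smooth_bump\<close>).
\<close>

section \<open>Calculus of smooth functions on Euclidean space\<close>

lemma partial_deriv_eqI:
  "(f has_derivative f') (at a) \<Longrightarrow> partial_deriv i f a = f' (axis i 1)"
  unfolding partial_deriv_def by (drule frechet_derivative_at) simp

text \<open>
  This includes functions that are not differentiable at \<open>a\<close>: \<open>frechet_derivative\<close> is a choice from the
  set of all derivatives, and that set, empty or not, depends on the germ only.
\<close>

lemma partial_deriv_cong:
  assumes "open S" "a \<in> S" "\<And>b. b \<in> S \<Longrightarrow> f b = g b"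
  shows "partial_deriv i f a = partial_deriv i g a"
proof -
  have "(f has_derivative f') (at a) \<longleftrightarrow> (g has_derivative f') (at a)" for f'
    using has_derivative_transform_within_open[OF _ assms(1,2)] assms(3) by metis
  then show ?thesis unfolding partial_deriv_def frechet_derivative_def by simp
qed

lemma frechet_derivative_partials:
  assumes "f differentiable at a"
  shows "frechet_derivative f (at a) v = (\<Sum>b\<in>UNIV. v $ b * partial_deriv b f a)"
proof -
  have lin: "linear (frechet_derivative f (at a))"
    using assms by (rule linear_frechet_derivative)
  have "frechet_derivative f (at a) v = frechet_derivative f (at a) (\<Sum>b\<in>UNIV. v $ b *\<^sub>R axis b 1)"
    using basis_expansion[of v] by (simp add: scalar_mult_eq_scaleR)
  also have "\<dots> = (\<Sum>b\<in>UNIV. v $ b * partial_deriv b f a)"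
    by (simp add: linear_sum[OF lin] linear_cmul[OF lin] partial_deriv_def)
  finally show ?thesis .
qed

lemma partial_deriv_const [simp]: "partial_deriv i (\<lambda>a. c) = (\<lambda>a. 0)"
  by (simp add: fun_eq_iff partial_deriv_def)

lemma partial_deriv_component:
  "partial_deriv (i::'n::finite) (\<lambda>a. a $ b) = (\<lambda>a. if i = b then 1 else 0)"
proof
  fix a :: "real^'n"
  have "((\<lambda>a. a $ b) has_derivative (\<lambda>h. h $ b)) (at a)"
    by (intro bounded_linear_imp_has_derivative bounded_linear_vec_nth)
  from partial_deriv_eqI[OF this, of i]
  show "partial_deriv i (\<lambda>a. a $ b) a = (if i = b then 1 else 0)" by (simp add: axis_def)
qed

lemma partial_deriv_add:
  assumes "f differentiable at a" "g differentiable at a"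
  shows "partial_deriv i (\<lambda>a. f a + g a) a = partial_deriv i f a + partial_deriv i g a"
  unfolding partial_deriv_def
  by (rule fun_cong[OF frechet_derivative_at[symmetric], of _ _ _ "axis i 1"])
    (use assms in \<open>auto intro!: has_derivative_add simp: frechet_derivative_works\<close>)

lemma partial_deriv_mult:
  assumes "f differentiable at a" "g differentiable at a"
  shows "partial_deriv i (\<lambda>a. f a * g a) a = f a * partial_deriv i g a + partial_deriv i f a * g a"
  using partial_deriv_eqI[OF has_derivative_mult[OF assms[unfolded frechet_derivative_works]]]
  by (simp add: partial_deriv_def)

lemma differentiable_vec_components:
  fixes y :: "real^'m \<Rightarrow> real^'n"
  assumes "\<And>b. (\<lambda>a. y a $ b) differentiable at a"
  shows "y differentiable at a"
  using assms by (subst differentiable_componentwise_within) (auto simp: Basis_vec_def inner_axis)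

lemma partial_deriv_chain:
  fixes y :: "real^'m \<Rightarrow> real^'n"
  assumes y: "\<And>b. (\<lambda>a. y a $ b) differentiable at a" and f: "f differentiable at (y a)"
  shows "partial_deriv i (\<lambda>a. f (y a)) a =
    (\<Sum>b\<in>UNIV. partial_deriv i (\<lambda>a. y a $ b) a * partial_deriv b f (y a))"
proof -
  let ?y' = "frechet_derivative y (at a)"
  have y': "(y has_derivative ?y') (at a)"
    using differentiable_vec_components[of y, OF y] by (simp add: frechet_derivative_works)
  have f': "(f has_derivative frechet_derivative f (at (y a))) (at (y a))"
    using f by (simp add: frechet_derivative_works)
  have "partial_deriv i (\<lambda>a. f (y a)) a = frechet_derivative f (at (y a)) (?y' (axis i 1))"
    by (rule partial_deriv_eqI[OF has_derivative_compose[OF y' f']])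
  also have "\<dots> = (\<Sum>b\<in>UNIV. ?y' (axis i 1) $ b * partial_deriv b f (y a))"
    by (rule frechet_derivative_partials[OF f])
  also have "\<dots> = (\<Sum>b\<in>UNIV. partial_deriv i (\<lambda>a. y a $ b) a * partial_deriv b f (y a))"
  proof (rule sum.cong)
    fix b
    have "((\<lambda>a. y a $ b) has_derivative (\<lambda>h. ?y' h $ b)) (at a)"
      by (rule bounded_linear.has_derivative[OF bounded_linear_vec_nth y'])
    from partial_deriv_eqI[OF this, of i]
    show "?y' (axis i 1) $ b * partial_deriv b f (y a) =
      partial_deriv i (\<lambda>a. y a $ b) a * partial_deriv b f (y a)" by simp
  qed simp
  finally show ?thesis .
qed

lemma Ck_on_Suc_open:
  "open S \<Longrightarrow> Ck_on (Suc k) f S \<longleftrightarrow>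
    (\<forall>a\<in>S. f differentiable at a) \<and> (\<forall>i. Ck_on k (partial_deriv i f) S)"
  by (simp add: differentiable_on_eq_differentiable_at)

lemma Ck_on_subset: "Ck_on k f S \<Longrightarrow> T \<subseteq> S \<Longrightarrow> Ck_on k f T"
  by (induction k arbitrary: f) (auto intro: continuous_on_subset differentiable_on_subset)

lemma Ck_on_Suc_imp: "Ck_on (Suc k) f S \<Longrightarrow> Ck_on k f S"
proof (induction k arbitrary: f)
  case 0 then show ?case by (simp add: differentiable_imp_continuous_on)
next
  case (Suc k)
  then have "\<forall>i. Ck_on (Suc k) (partial_deriv i f) S" and "f differentiable_on S"
    by (auto simp del: Ck_on.simps(1))
  then show ?case using Suc.IH by (subst Ck_on.simps) blast
qed

text \<open>
  This replaces a partial derivative by a formula for it that is valid on \<open>S\<close> only, which is the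
  induction step of all the closure properties below.
\<close>

lemma Ck_on_cong:
  assumes "open S" "\<And>a. a \<in> S \<Longrightarrow> f a = g a" "Ck_on k f S"
  shows "Ck_on k g S"
  using assms(2,3)
proof (induction k arbitrary: f g)
  case 0 then show ?case by (simp add: continuous_on_cong[of S S f g])
next
  case (Suc k)
  have "g differentiable at a" if "a \<in> S" for a
  proof -
    have "f differentiable at a"
      using Suc.prems(2) that by (simp add: differentiable_on_eq_differentiable_at[OF assms(1)])
    then obtain f' where "(f has_derivative f') (at a)" by (auto simp: differentiable_def)
    then have "(g has_derivative f') (at a)"
      by (rule has_derivative_transform_within_open[OF _ assms(1) that Suc.prems(1)])
    then show ?thesis by (auto simp: differentiable_def)
  qed
  moreover have "Ck_on k (partial_deriv i g) S" for i
  proof (rule Suc.IH)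
    show "Ck_on k (partial_deriv i f) S" using Suc.prems(2) by simp
    show "partial_deriv i f a = partial_deriv i g a" if "a \<in> S" for a
      using partial_deriv_cong[OF assms(1) that Suc.prems(1)] .
  qed
  ultimately show ?case by (simp only: Ck_on_Suc_open[OF assms(1)]) blast
qed

lemma Ck_on_local:
  assumes "open S" "\<And>a. a \<in> S \<Longrightarrow> \<exists>T. open T \<and> a \<in> T \<and> Ck_on k f T"
  shows "Ck_on k f S"
  using assms(2)
proof (induction k arbitrary: f)
  case 0
  have "isCont f a" if "a \<in> S" for a
    using 0[OF that] continuous_on_eq_continuous_at by fastforce
  then show ?case by (simp add: continuous_at_imp_continuous_on)
next
  case (Suc k)
  have "f differentiable at a" if "a \<in> S" for a
    using Suc.prems[OF that] Ck_on_Suc_open by blast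
  moreover have "Ck_on k (partial_deriv i f) S" for i
  proof (rule Suc.IH)
    fix a assume "a \<in> S"
    then obtain T where "open T" "a \<in> T" "Ck_on (Suc k) f T" using Suc.prems by blast
    then show "\<exists>T. open T \<and> a \<in> T \<and> Ck_on k (partial_deriv i f) T" by auto
  qed
  ultimately show ?case by (simp only: Ck_on_Suc_open[OF assms(1)]) blast
qed

lemma Ck_on_const: "Ck_on k (\<lambda>a. c) S"
  by (induction k arbitrary: c) auto

lemma Ck_on_component: "Ck_on k (\<lambda>a. a $ b) S"
proof (cases k)
  case 0 then show ?thesis by (auto intro!: continuous_intros)
next
  case (Suc k)
  have "(\<lambda>a. a $ b) differentiable_on S"
    by (intro linear_imp_differentiable_on bounded_linear.linear[OF bounded_linear_vec_nth])
  then show ?thesis using Suc Ck_on_const by (auto simp: partial_deriv_component)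
qed

lemma Ck_on_add:
  assumes "open S"
  shows "Ck_on k f S \<Longrightarrow> Ck_on k g S \<Longrightarrow> Ck_on k (\<lambda>a. f a + g a) S"
proof (induction k arbitrary: f g)
  case 0 then show ?case by (auto intro: continuous_intros)
next
  case (Suc k)
  note d = Suc.prems[unfolded Ck_on_Suc_open[OF assms]]
  show ?case unfolding Ck_on_Suc_open[OF assms]
  proof (intro conjI ballI allI)
    fix a i assume "a \<in> S" then show "(\<lambda>a. f a + g a) differentiable at a" using d by auto
  next
    fix i
    have "Ck_on k (\<lambda>a. partial_deriv i f a + partial_deriv i g a) S"
      by (intro Suc.IH) (use d in blast)+
    then show "Ck_on k (partial_deriv i (\<lambda>a. f a + g a)) S"
      using d by (elim Ck_on_cong[OF assms, rotated]) (simp add: partial_deriv_add)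
  qed
qed

lemma Ck_on_mult:
  assumes "open S"
  shows "Ck_on k f S \<Longrightarrow> Ck_on k g S \<Longrightarrow> Ck_on k (\<lambda>a. f a * g a) S"
proof (induction k arbitrary: f g)
  case 0 then show ?case by (auto intro: continuous_intros)
next
  case (Suc k)
  note d = Suc.prems[unfolded Ck_on_Suc_open[OF assms]]
  show ?case unfolding Ck_on_Suc_open[OF assms]
  proof (intro conjI ballI allI)
    fix a i assume "a \<in> S" then show "(\<lambda>a. f a * g a) differentiable at a" using d by auto
  next
    fix i
    have "Ck_on k (\<lambda>a. f a * partial_deriv i g a + partial_deriv i f a * g a) S"
      by (intro Ck_on_add assms Suc.IH) (use d Suc.prems Ck_on_Suc_imp in blast)+
    then show "Ck_on k (partial_deriv i (\<lambda>a. f a * g a)) S"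
      using d by (elim Ck_on_cong[OF assms, rotated]) (simp add: partial_deriv_mult)
  qed
qed

lemma Ck_on_sum:
  assumes "open S" "finite I" "\<And>b. b \<in> I \<Longrightarrow> Ck_on k (f b) S"
  shows "Ck_on k (\<lambda>a. \<Sum>b\<in>I. f b a) S"
  using assms(2,3) by (induction I) (auto intro: Ck_on_const Ck_on_add assms(1))

text \<open>
  By induction on \<open>k\<close>: the chain rule expresses each partial derivative of the composition by products of
  \<open>C\<^sup>k\<close> functions and compositions of \<open>C\<^sup>k\<close> functions with \<open>y\<close>.
\<close>

lemma Ck_on_compose:
  fixes y :: "real^'m \<Rightarrow> real^'n"
  assumes "open S" "open T" "\<And>a. a \<in> S \<Longrightarrow> y a \<in> T"
  shows "(\<And>b. Ck_on k (\<lambda>a. y a $ b) S) \<Longrightarrow> Ck_on k f T \<Longrightarrow> Ck_on k (\<lambda>a. f (y a)) S"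
proof (induction k arbitrary: f)
  case 0
  then have "continuous_on S y"
    by (subst continuous_on_componentwise) (auto simp: Basis_vec_def inner_axis)
  moreover have "y ` S \<subseteq> T" using assms(3) by blast
  ultimately show ?case using 0(2) by (auto intro: continuous_on_compose2)
next
  case (Suc k)
  note dy = Suc.prems(1)[unfolded Ck_on_Suc_open[OF assms(1)]]
  note df = Suc.prems(2)[unfolded Ck_on_Suc_open[OF assms(2)]]
  show ?case unfolding Ck_on_Suc_open[OF assms(1)]
  proof (intro conjI ballI allI)
    fix a i assume a: "a \<in> S"
    have "y differentiable at a"
      by (rule differentiable_vec_components) (rule dy[THEN conjunct1, rule_format, OF a])
    moreover have "f differentiable at (y a)" using df assms(3)[OF a] by simp
    ultimately show "(\<lambda>a. f (y a)) differentiable at a"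
      using differentiable_chain_at[of y a f] by (simp add: o_def)
  next
    fix i
    have "Ck_on k (\<lambda>a. partial_deriv b f (y a)) S" for b
      by (rule Suc.IH) (use df Ck_on_Suc_imp[OF Suc.prems(1)] in auto)
    then have "Ck_on k (\<lambda>a. \<Sum>b\<in>UNIV. partial_deriv i (\<lambda>a. y a $ b) a * partial_deriv b f (y a)) S"
      by (intro Ck_on_sum Ck_on_mult assms) (use dy in auto)
    then show "Ck_on k (partial_deriv i (\<lambda>a. f (y a))) S"
      by (elim Ck_on_cong[OF assms(1), rotated])
        (use dy df assms(3) in \<open>simp add: partial_deriv_chain\<close>)
  qed
qed

text \<open>
  The classical argument for the symmetry of second derivatives. The left-hand side is the increment
  over \<open>[0, h]\<close> of the difference \<open>s \<mapsto> f(a + h e\<^sub>j + s e\<^sub>i) - f(a + s e\<^sub>i)\<close>; the mean value theorem in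
  \<open>s\<close> and then in the direction \<open>e\<^sub>j\<close> gives the right-hand side. As the left-hand side is symmetric in \<open>i\<close> and
  \<open>j\<close>, letting \<open>h\<close> tend to \<open>0\<close> will compare the two mixed derivatives.
\<close>

lemma second_difference_mean_value:
  fixes f :: "real^'n \<Rightarrow> real"
  assumes "open S" "Ck_on 2 f S" "0 < h"
    and S: "\<And>s t. 0 \<le> s \<Longrightarrow> s \<le> h \<Longrightarrow> 0 \<le> t \<Longrightarrow> t \<le> h \<Longrightarrow> a + s *\<^sub>R axis i 1 + t *\<^sub>R axis j 1 \<in> S"
  shows "\<exists>s t. 0 \<le> s \<and> s \<le> h \<and> 0 \<le> t \<and> t \<le> h \<and>
    f (a + h *\<^sub>R axis i 1 + h *\<^sub>R axis j 1) - f (a + h *\<^sub>R axis i 1)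
      - f (a + h *\<^sub>R axis j 1) + f a
    = h * h * partial_deriv j (partial_deriv i f) (a + s *\<^sub>R axis i 1 + t *\<^sub>R axis j 1)"
proof -
  let ?i = "axis i 1 :: real^'n" and ?j = "axis j 1 :: real^'n"
  have line: "((\<lambda>s. F (b + s *\<^sub>R axis l 1)) has_real_derivative partial_deriv l F (b + s *\<^sub>R axis l 1)) (at s)"
    if F: "F differentiable at (b + s *\<^sub>R axis l 1)" for F :: "real^'n \<Rightarrow> real" and b l s
  proof -
    have "((\<lambda>s. F (b + s *\<^sub>R axis l 1)) has_derivative
      (\<lambda>r. frechet_derivative F (at (b + s *\<^sub>R axis l 1)) (r *\<^sub>R axis l 1))) (at s)"
      by (rule has_derivative_compose[of _ _ _ _ F])
        (auto intro!: derivative_eq_intros F[unfolded frechet_derivative_works])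
    moreover have "(\<lambda>r. frechet_derivative F (at (b + s *\<^sub>R axis l 1)) (r *\<^sub>R axis l 1))
      = (*) (partial_deriv l F (b + s *\<^sub>R axis l 1))"
      by (simp add: fun_eq_iff linear_cmul[OF linear_frechet_derivative[OF F]] partial_deriv_def)
    ultimately show ?thesis by (simp add: has_field_derivative_def)
  qed
  have df: "f differentiable at b" "partial_deriv i f differentiable at b" if "b \<in> S" for b
    using assms(1,2) that by (auto simp: numeral_2_eq_2 differentiable_on_eq_differentiable_at)
  define G where "G = (\<lambda>s. f (a + h *\<^sub>R ?j + s *\<^sub>R ?i) - f (a + s *\<^sub>R ?i))"
  have "\<exists>s>0. s < h \<and> G h - G 0 = (h - 0) *
      (partial_deriv i f (a + h *\<^sub>R ?j + s *\<^sub>R ?i) - partial_deriv i f (a + s *\<^sub>R ?i))"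
  proof (rule MVT2[OF \<open>0 < h\<close>])
    fix s assume "0 \<le> s" "s \<le> h"
    then have "a + h *\<^sub>R ?j + s *\<^sub>R ?i \<in> S" "a + s *\<^sub>R ?i \<in> S"
      using S[of s h] S[of s 0] \<open>0 < h\<close> by (auto simp: algebra_simps)
    then show "(G has_real_derivative
      (partial_deriv i f (a + h *\<^sub>R ?j + s *\<^sub>R ?i) - partial_deriv i f (a + s *\<^sub>R ?i))) (at s)"
      unfolding G_def by (intro DERIV_diff line df)
  qed
  then obtain s where s: "0 < s" "s < h" "G h - G 0 = h *
      (partial_deriv i f (a + h *\<^sub>R ?j + s *\<^sub>R ?i) - partial_deriv i f (a + s *\<^sub>R ?i))" by auto
  have "\<exists>t>0. t < h \<and> partial_deriv i f (a + s *\<^sub>R ?i + h *\<^sub>R ?j) - partial_deriv i f (a + s *\<^sub>R ?i + 0 *\<^sub>R ?j)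
     = (h - 0) * partial_deriv j (partial_deriv i f) (a + s *\<^sub>R ?i + t *\<^sub>R ?j)"
    by (rule MVT2[OF \<open>0 < h\<close>]) (use s S in \<open>auto intro!: line df\<close>)
  then obtain t where t: "0 < t" "t < h"
    "partial_deriv i f (a + s *\<^sub>R ?i + h *\<^sub>R ?j) - partial_deriv i f (a + s *\<^sub>R ?i)
     = h * partial_deriv j (partial_deriv i f) (a + s *\<^sub>R ?i + t *\<^sub>R ?j)" by auto
  have "G h - G 0 = h * h * partial_deriv j (partial_deriv i f) (a + s *\<^sub>R ?i + t *\<^sub>R ?j)"
    using s(3) t(3) by (simp add: algebra_simps)
  moreover have "G h - G 0 = f (a + h *\<^sub>R ?i + h *\<^sub>R ?j) - f (a + h *\<^sub>R ?i) - f (a + h *\<^sub>R ?j) + f a"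
    unfolding G_def by (simp add: add_ac)
  ultimately show ?thesis using s t by (metis less_imp_le)
qed

lemma mixed_partials_commute:
  fixes f :: "real^'n \<Rightarrow> real"
  assumes "open S" "Ck_on 2 f S" "a \<in> S"
  shows "partial_deriv j (partial_deriv i f) a = partial_deriv i (partial_deriv j f) a"
proof (rule ccontr)
  let ?P = "partial_deriv j (partial_deriv i f)" and ?Q = "partial_deriv i (partial_deriv j f)"
  assume "?P a \<noteq> ?Q a"
  then have e: "0 < \<bar>?P a - ?Q a\<bar> / 2" (is "0 < ?e") by simp
  have "isCont ?P a" "isCont ?Q a"
    using assms by (auto simp: numeral_2_eq_2 continuous_on_eq_continuous_at)
  then have "eventually (\<lambda>b. b \<in> S \<and> dist (?P b) (?P a) < ?e \<and> dist (?Q b) (?Q a) < ?e) (nhds a)"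
    unfolding isCont_def tendsto_at_iff_tendsto_nhds using e assms
    by (intro eventually_conj tendstoD eventually_nhds_in_open) auto
  then obtain d where d: "d > 0"
    "\<And>b. dist b a < d \<Longrightarrow> b \<in> S \<and> dist (?P b) (?P a) < ?e \<and> dist (?Q b) (?Q a) < ?e"
    unfolding eventually_nhds_metric by blast
  \<comment> \<open>Any point of the square of side \<open>h\<close> has distance at most \<open>2h < d\<close> from its corner \<open>a\<close>.\<close>
  define h where "h = d / 3"
  have h: "h > 0" using d by (simp add: h_def)
  have near: "dist (a + s *\<^sub>R axis k 1 + t *\<^sub>R axis l 1) a < d"
    if "0 \<le> s" "s \<le> h" "0 \<le> t" "t \<le> h" for s t k l
  proof -
    have "dist (a + s *\<^sub>R axis k 1 + t *\<^sub>R axis l 1) a = norm (s *\<^sub>R axis k 1 + t *\<^sub>R axis l (1::real))"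
      by (simp add: dist_norm add.assoc)
    also have "\<dots> \<le> s + t"
      using norm_triangle_ineq[of "s *\<^sub>R axis k (1::real)" "t *\<^sub>R axis l 1"] that by simp
    also have "\<dots> < d" using that d(1) by (simp add: h_def)
    finally show ?thesis .
  qed
  obtain s t where 1: "0 \<le> s" "s \<le> h" "0 \<le> t" "t \<le> h"
    "f (a + h *\<^sub>R axis i 1 + h *\<^sub>R axis j 1) - f (a + h *\<^sub>R axis i 1) - f (a + h *\<^sub>R axis j 1) + f a
      = h * h * ?P (a + s *\<^sub>R axis i 1 + t *\<^sub>R axis j 1)"
    using second_difference_mean_value[OF assms(1,2) h, of a i j] near d(2) by blast
  obtain s' t' where 2: "0 \<le> s'" "s' \<le> h" "0 \<le> t'" "t' \<le> h"
    "f (a + h *\<^sub>R axis j 1 + h *\<^sub>R axis i 1) - f (a + h *\<^sub>R axis j 1) - f (a + h *\<^sub>R axis i 1) + f a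
      = h * h * ?Q (a + s' *\<^sub>R axis j 1 + t' *\<^sub>R axis i 1)"
    using second_difference_mean_value[OF assms(1,2) h, of a j i] near d(2) by blast
  have "h * h * ?P (a + s *\<^sub>R axis i 1 + t *\<^sub>R axis j 1) = h * h * ?Q (a + s' *\<^sub>R axis j 1 + t' *\<^sub>R axis i 1)"
    using 1(5) 2(5) by (simp add: algebra_simps)
  then have "?P (a + s *\<^sub>R axis i 1 + t *\<^sub>R axis j 1) = ?Q (a + s' *\<^sub>R axis j 1 + t' *\<^sub>R axis i 1)"
    using h by simp
  moreover have "dist (?P (a + s *\<^sub>R axis i 1 + t *\<^sub>R axis j 1)) (?P a) < ?e"
    "dist (?Q (a + s' *\<^sub>R axis j 1 + t' *\<^sub>R axis i 1)) (?Q a) < ?e"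
    using near d(2) 1 2 by blast+
  ultimately show False unfolding dist_real_def by (smt (verit) field_sum_of_halves)
qed

section \<open>A smooth bump function\<close>

text \<open>
  The derivatives of \<open>exp(-1/t)\<close>, extended by \<open>0\<close> to \<open>t \<le> 0\<close>, are linear combinations of the functions
  \<open>exp(-1/t) / t\<^sup>m\<close>. The span of this family is closed under differentiation, so that smoothness
  follows by one induction on the order of differentiability, for all \<open>m\<close> at once.
\<close>

definition flat :: "nat \<Rightarrow> real \<Rightarrow> real" where
  "flat m t = (if t > 0 then exp (- (1 / t)) / t ^ m else 0)"

lemma flat_tendsto_0: "(flat m \<longlongrightarrow> 0) (at 0)"
proof (rule filterlim_split_at)
  show "(flat m \<longlongrightarrow> 0) (at_left 0)"
    by (rule tendsto_eventually)
      (auto simp: flat_def eventually_at_filter intro!: always_eventually)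
  have "((\<lambda>t. inverse t ^ m / exp (inverse t)) \<longlongrightarrow> (0::real)) (at_right 0)"
    by (rule filterlim_compose[OF tendsto_power_div_exp_0 filterlim_inverse_at_top_right])
  then show "(flat m \<longlongrightarrow> 0) (at_right 0)"
    by (rule Lim_transform_eventually)
      (auto simp: flat_def eventually_at_filter exp_minus field_simps intro!: always_eventually)
qed

lemma flat_has_derivative:
  "(flat m has_real_derivative flat (m + 2) t - real m * flat (m + 1) t) (at t)"
proof -
  consider "t > 0" | "t < 0" | "t = 0" by linarith
  then show ?thesis
  proof cases
    case 1
    have "((\<lambda>t. exp (- (1 / t)) / t ^ m) has_real_derivative
        flat (m + 2) t - real m * flat (m + 1) t) (at t)"
    proof (cases m)
      case 0
      then show ?thesis using 1
        by (auto intro!: derivative_eq_intros simp: flat_def divide_simps power2_eq_square)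
    next
      case (Suc l)
      then show ?thesis using 1
        by (auto intro!: derivative_eq_intros simp: flat_def divide_simps power2_eq_square)
          (cases l; simp add: algebra_simps)
    qed
    then show ?thesis
      by (rule has_field_derivative_transform_within_open[of _ _ _ "{0<..}"]) (use 1 in \<open>auto simp: flat_def\<close>)
  next
    case 2
    have "((\<lambda>t. 0) has_real_derivative 0) (at t)" by simp
    then have "(flat m has_real_derivative 0) (at t)"
      by (rule has_field_derivative_transform_within_open[of _ _ _ "{..<0}"]) (use 2 in \<open>auto simp: flat_def\<close>)
    then show ?thesis using 2 by (simp add: flat_def)
  next
    case 3
    \<comment> \<open>The difference quotient at \<open>0\<close> is again a function of the family.\<close>
    have "((\<lambda>h. (flat m (0 + h) - flat m 0) / h) \<longlongrightarrow> 0) (at 0)"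
      by (rule Lim_transform_eventually[OF flat_tendsto_0[of "m + 1"]])
        (auto simp: flat_def eventually_at_filter intro!: always_eventually)
    then have "(flat m has_real_derivative 0) (at 0)" by (simp add: DERIV_def)
    then show ?thesis using 3 by (simp add: flat_def)
  qed
qed

lemma Ck_on_flat:
  assumes "open S" "C_infinity_on q S"
  shows "Ck_on k (\<lambda>a. flat m (q a)) S"
proof (induction k arbitrary: m)
  case 0
  have "continuous_on UNIV (flat m)"
    using flat_has_derivative DERIV_isCont continuous_at_imp_continuous_on by blast
  moreover have "continuous_on S q"
    using assms(2)[unfolded C_infinity_on_def, THEN spec, of 0] by simp
  ultimately show ?case by (auto intro: continuous_on_compose2)
next
  case (Suc k)
  have q: "q differentiable at a" if "a \<in> S" for a
    using assms that Ck_on_Suc_open[OF assms(1), of 0 q] unfolding C_infinity_on_def by blast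
  have q': "Ck_on k (partial_deriv i q) S" for i
    using assms(2) Ck_on.simps(2)[of k q S] unfolding C_infinity_on_def by blast
  have deriv: "((\<lambda>a. flat m (q a)) has_derivative
      (\<lambda>h. (flat (m + 2) (q a) - real m * flat (m + 1) (q a)) * frechet_derivative q (at a) h)) (at a)"
    if "a \<in> S" for a
    using has_derivative_compose[OF q[OF that, unfolded frechet_derivative_works]
        flat_has_derivative[of m "q a", unfolded has_field_derivative_def]] .
  show ?case unfolding Ck_on_Suc_open[OF assms(1)]
  proof (intro conjI ballI allI)
    fix a i assume "a \<in> S"
    then show "(\<lambda>a. flat m (q a)) differentiable at a" using deriv unfolding differentiable_def by blast
  next
    fix i
    have "Ck_on k (\<lambda>a. (flat (m + 2) (q a) + - real m * flat (m + 1) (q a)) * partial_deriv i q a) S"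
      by (intro Ck_on_mult Ck_on_add Ck_on_const Suc.IH q' assms)
    then show "Ck_on k (partial_deriv i (\<lambda>a. flat m (q a))) S"
      by (elim Ck_on_cong[OF assms(1), rotated])
        (use partial_deriv_eqI[OF deriv] in \<open>simp add: partial_deriv_def\<close>)
  qed
qed

text \<open>
  Write \<open>u\<close> for \<open>flat 0\<close>. The function \<open>t \<mapsto> e u(1 - e u(t))\<close> is \<open>e u(1) = 1\<close> for \<open>t \<le> 0\<close>, and \<open>0\<close> for
  \<open>t \<ge> 1\<close> because there \<open>u(t) \<ge> u(1) = 1/e\<close>. Iterating \<open>u\<close> in this way avoids the division in the usual
  construction of a bump function. The quadratic function \<open>q\<close> below, put in place of \<open>t\<close>,
  takes the values \<open>0\<close> and \<open>1\<close> on the spheres of radius \<open>r/\<surd>2 > r/2\<close> and \<open>r\<close>.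
\<close>

lemma smooth_bump:
  fixes a0 :: "real^'n"
  assumes "r > 0"
  obtains \<phi> :: "real^'n \<Rightarrow> real" where "C_infinity_on \<phi> UNIV"
    "\<And>a. dist a a0 < r / 2 \<Longrightarrow> \<phi> a = 1" "\<And>a. dist a a0 \<ge> r \<Longrightarrow> \<phi> a = 0"
proof
  define q :: "real^'n \<Rightarrow> real" where "q = (\<lambda>a. 2 / r^2 * (\<Sum>i\<in>UNIV. (a $ i + - a0 $ i) * (a $ i + - a0 $ i)) + - 1)"
  define \<phi> :: "real^'n \<Rightarrow> real" where "\<phi> = (\<lambda>a. exp 1 * flat 0 (1 + - exp 1 * flat 0 (q a)))"
  have q: "q a = 2 * (dist a a0 / r)^2 - 1" for a
    by (simp add: q_def dist_norm norm_vec_def L2_set_def sum_nonneg power_divide flip: power2_eq_square)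
  have "C_infinity_on q UNIV"
    unfolding C_infinity_on_def q_def
    by (intro allI Ck_on_add Ck_on_mult Ck_on_sum Ck_on_const Ck_on_component) auto
  then have "C_infinity_on (\<lambda>a. 1 + - exp 1 * flat 0 (q a)) UNIV"
    by (subst C_infinity_on_def) (intro allI Ck_on_add Ck_on_mult Ck_on_const Ck_on_flat; auto)
  then show "C_infinity_on \<phi> UNIV"
    unfolding \<phi>_def by (subst C_infinity_on_def) (intro allI Ck_on_mult Ck_on_const Ck_on_flat; auto)
  show "\<phi> a = 1" if "dist a a0 < r / 2" for a
  proof -
    have "(dist a a0 / r)^2 \<le> (1/2)^2"
      using that assms by (intro power_mono) (auto simp: field_simps)
    also have "\<dots> = 1 / 4" by (simp add: power2_eq_square)
    finally have "q a \<le> 0" unfolding q by linarith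
    then show ?thesis by (simp add: \<phi>_def flat_def exp_minus)
  qed
  show "\<phi> a = 0" if "dist a a0 \<ge> r" for a
  proof -
    have "1^2 \<le> (dist a a0 / r)^2"
      using that assms by (intro power_mono) (auto simp: field_simps)
    then have "1 \<le> q a" unfolding q by simp
    then have "exp (-1) \<le> exp (- (1 / q a))" by simp
    then have "exp (-1) \<le> flat 0 (q a)" using \<open>1 \<le> q a\<close> by (simp add: flat_def)
    then have "exp 1 * exp (-1) \<le> exp 1 * flat 0 (q a)" by simp
    then show ?thesis by (simp add: \<phi>_def flat_def exp_minus)
  qed
qed

section \<open>Closure properties of smooth functions\<close>

lemma C_infinity_on_subset: "C_infinity_on f S \<Longrightarrow> T \<subseteq> S \<Longrightarrow> C_infinity_on f T"
  unfolding C_infinity_on_def using Ck_on_subset by blast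

lemma C_infinity_on_cong:
  "open S \<Longrightarrow> (\<And>a. a \<in> S \<Longrightarrow> f a = g a) \<Longrightarrow> C_infinity_on f S \<Longrightarrow> C_infinity_on g S"
  unfolding C_infinity_on_def using Ck_on_cong[of S f g] by simp

lemma C_infinity_on_const: "C_infinity_on (\<lambda>a. c) S"
  by (simp add: C_infinity_on_def Ck_on_const)

lemma C_infinity_on_component: "C_infinity_on (\<lambda>a. a $ b) S"
  by (simp add: C_infinity_on_def Ck_on_component)

lemma C_infinity_on_add:
  "open S \<Longrightarrow> C_infinity_on f S \<Longrightarrow> C_infinity_on g S \<Longrightarrow> C_infinity_on (\<lambda>a. f a + g a) S"
  by (simp add: C_infinity_on_def Ck_on_add)

lemma C_infinity_on_mult:
  "open S \<Longrightarrow> C_infinity_on f S \<Longrightarrow> C_infinity_on g S \<Longrightarrow> C_infinity_on (\<lambda>a. f a * g a) S"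
  by (simp add: C_infinity_on_def Ck_on_mult)

lemma C_infinity_on_partial_deriv: "C_infinity_on f S \<Longrightarrow> C_infinity_on (partial_deriv i f) S"
  unfolding C_infinity_on_def using Ck_on.simps(2) by blast

lemma C_infinity_on_differentiable:
  "open S \<Longrightarrow> C_infinity_on f S \<Longrightarrow> a \<in> S \<Longrightarrow> f differentiable at a"
  unfolding C_infinity_on_def using Ck_on_Suc_open by blast

section \<open>Charts and smooth functions on a manifold\<close>

lemma topological_chart_inv:
  assumes "topological_chart (x, U)" "q \<in> U"
  shows "inv_into U x (x q) = q"
  using assms by (auto simp: topological_chart_def homeomorphism_def)

lemma topological_chart_open_image:
  assumes "topological_chart (x, U)" "open W" "W \<subseteq> U"
  shows "open (x ` W)"
proof -
  have U: "open U" "open (x ` U)" "homeomorphism U (x ` U) x (inv_into U x)"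
    using assms(1) by (auto simp: topological_chart_def)
  have "openin (top_of_set U) W" using assms U(1) by (simp add: openin_open_eq)
  from homeomorphism_imp_open_map[OF U(3) this] show ?thesis using U(2) openin_open_eq by blast
qed

lemma C_infinity_on_change_chart:
  assumes x: "topological_chart (x, U)" and y: "topological_chart (y, V)"
    and trans: "smooth_transition (x, U) (y, V)"
    and W: "open W" "W \<subseteq> U" "W \<subseteq> V"
    and f: "C_infinity_on (\<lambda>a. f (inv_into V y a)) (y ` W)"
  shows "C_infinity_on (\<lambda>a. f (inv_into U x a)) (x ` W)"
proof -
  have ox: "open (x ` W)" and oy: "open (y ` W)"
    using topological_chart_open_image x y W by blast+
  have inW: "inv_into U x a \<in> W" if "a \<in> x ` W" for a
    using that topological_chart_inv[OF x] W by auto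
  have comp: "Ck_on k (\<lambda>a. y (inv_into U x a) $ b) (x ` W)" for k b
  proof (rule Ck_on_subset)
    show "Ck_on k (\<lambda>a. y (inv_into U x a) $ b) (x ` (U \<inter> V))"
      using trans by (simp add: smooth_transition_def C_infinity_on_def)
    show "x ` W \<subseteq> x ` (U \<inter> V)" using W by blast
  qed
  have "C_infinity_on (\<lambda>a. f (inv_into V y (y (inv_into U x a)))) (x ` W)"
    unfolding C_infinity_on_def
  proof
    fix k
    show "Ck_on k (\<lambda>a. f (inv_into V y (y (inv_into U x a)))) (x ` W)"
      by (rule Ck_on_compose[OF ox oy _ comp, where f = "\<lambda>b. f (inv_into V y b)"])
        (use inW f in \<open>auto simp: C_infinity_on_def\<close>)
  qed
  then show ?thesis
    by (rule C_infinity_on_cong[OF ox, rotated])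
      (use inW W topological_chart_inv[OF y] in \<open>metis subsetD\<close>)
qed

lemma smooth_fun_onD:
  "smooth_fun_on A W f \<Longrightarrow> (x, U) \<in> A \<Longrightarrow> C_infinity_on (\<lambda>a. f (inv_into U x a)) (x ` (U \<inter> W))"
  "smooth_fun_on A W f \<Longrightarrow> open W"
  by (auto simp: smooth_fun_on_def)

lemma smooth_nearI: "smooth_fun_on A W f \<Longrightarrow> p \<in> W \<Longrightarrow> smooth_near A p f"
  by (auto simp: smooth_near_def)

locale manifold =
  fixes A :: "('a::t2_space, 'n::finite) chart set"
  assumes atlas: "smooth_atlas A"
begin

lemma charts_topological: "c \<in> charts A \<Longrightarrow> topological_chart c"
  by (auto simp: charts_def)

lemma charts_open: "(x, U) \<in> charts A \<Longrightarrow> open U"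
  using charts_topological by (fastforce simp: topological_chart_def)

lemma charts_transition:
  "c \<in> charts A \<Longrightarrow> d \<in> A \<Longrightarrow> smooth_transition c d \<and> smooth_transition d c"
  by (auto simp: charts_def)

lemma atlas_subset_charts: "A \<subseteq> charts A"
  using atlas by (auto simp: charts_def smooth_atlas_def)

lemma atlas_chart_at: obtains y V where "(y, V) \<in> A" "p \<in> V"
proof -
  have "p \<in> (\<Union>(x, U)\<in>A. U)" using atlas by (simp add: smooth_atlas_def)
  then show ?thesis using that by auto
qed

lemma chart_inv: "(x, U) \<in> charts A \<Longrightarrow> q \<in> U \<Longrightarrow> inv_into U x (x q) = q"
  using charts_topological topological_chart_inv by blast

lemma chart_open_image: "(x, U) \<in> charts A \<Longrightarrow> open W \<Longrightarrow> W \<subseteq> U \<Longrightarrow> open (x ` W)"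
  using charts_topological topological_chart_open_image by blast

lemma smooth_fun_on_subset:
  "smooth_fun_on A W f \<Longrightarrow> open W' \<Longrightarrow> W' \<subseteq> W \<Longrightarrow> smooth_fun_on A W' f"
  unfolding smooth_fun_on_def by (fastforce elim!: C_infinity_on_subset)

text \<open>
  Smoothness may be tested in any single chart of the maximal atlas that contains the set, and
  conversely (\<open>smooth_fun_on_rep\<close>) it is visible in each of them. These two lemmas carry every
  later argument over to one chart of choice.
\<close>

lemma smooth_fun_on_chartI:
  assumes x: "(x, U) \<in> charts A" and W: "open W" "W \<subseteq> U"
    and f: "C_infinity_on (\<lambda>a. f (inv_into U x a)) (x ` W)"
  shows "smooth_fun_on A W f"
proof -
  have "C_infinity_on (\<lambda>a. f (inv_into V y a)) (y ` (V \<inter> W))" if "(y, V) \<in> A" for y V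
  proof (rule C_infinity_on_change_chart[of y V x U])
    have y: "(y, V) \<in> charts A" using that atlas_subset_charts by blast
    show "topological_chart (y, V)" "topological_chart (x, U)" "smooth_transition (y, V) (x, U)"
      using charts_topological[OF x] charts_topological[OF y] charts_transition[OF x that] by auto
    show "open (V \<inter> W)" using W charts_open[OF y] by blast
    show "C_infinity_on (\<lambda>a. f (inv_into U x a)) (x ` (V \<inter> W))"
      using f by (rule C_infinity_on_subset) blast
  qed (use W in auto)
  then show ?thesis using W by (auto simp: smooth_fun_on_def)
qed

lemma smooth_fun_on_local:
  assumes "open W" "\<And>p. p \<in> W \<Longrightarrow> smooth_near A p f"
  shows "smooth_fun_on A W f"
proof -
  have "C_infinity_on (\<lambda>a. f (inv_into U x a)) (x ` (U \<inter> W))" if c: "(x, U) \<in> A" for x U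
    unfolding C_infinity_on_def
  proof
    fix k
    have x: "(x, U) \<in> charts A" using c atlas_subset_charts by blast
    show "Ck_on k (\<lambda>a. f (inv_into U x a)) (x ` (U \<inter> W))"
    proof (rule Ck_on_local)
      show "open (x ` (U \<inter> W))" using chart_open_image[OF x] charts_open[OF x] assms(1) by blast
      fix a assume "a \<in> x ` (U \<inter> W)"
      then obtain p where p: "p \<in> U" "p \<in> W" "a = x p" by blast
      then obtain W' where W': "p \<in> W'" "smooth_fun_on A W' f"
        using assms(2) by (auto simp: smooth_near_def)
      have "open (x ` (U \<inter> W'))"
        using chart_open_image[OF x] charts_open[OF x] smooth_fun_onD(2)[OF W'(2)] by blast
      moreover have "Ck_on k (\<lambda>a. f (inv_into U x a)) (x ` (U \<inter> W'))"
        using smooth_fun_onD(1)[OF W'(2) c] by (simp add: C_infinity_on_def)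
      ultimately show "\<exists>T. open T \<and> a \<in> T \<and> Ck_on k (\<lambda>a. f (inv_into U x a)) T"
        using p W' by blast
    qed
  qed
  then show ?thesis using assms(1) by (auto simp: smooth_fun_on_def)
qed

lemma smooth_fun_on_rep:
  assumes x: "(x, U) \<in> charts A" and f: "smooth_fun_on A W f"
  shows "C_infinity_on (\<lambda>a. f (inv_into U x a)) (x ` (U \<inter> W))"
  unfolding C_infinity_on_def
proof
  fix k
  have W: "open W" using f by (rule smooth_fun_onD)
  show "Ck_on k (\<lambda>a. f (inv_into U x a)) (x ` (U \<inter> W))"
  proof (rule Ck_on_local)
    show "open (x ` (U \<inter> W))" using chart_open_image[OF x] charts_open[OF x] W by blast
    fix a assume "a \<in> x ` (U \<inter> W)"
    then obtain p where p: "p \<in> U" "p \<in> W" "a = x p" by blast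
    obtain y V where c: "(y, V) \<in> A" "p \<in> V" by (rule atlas_chart_at)
    then have y: "(y, V) \<in> charts A" using atlas_subset_charts by blast
    let ?W = "U \<inter> V \<inter> W"
    have oW: "open ?W" using W charts_open[OF x] charts_open[OF y] by blast
    have "C_infinity_on (\<lambda>a. f (inv_into U x a)) (x ` ?W)"
    proof (rule C_infinity_on_change_chart[of x U y V])
      show "topological_chart (y, V)" "topological_chart (x, U)" "smooth_transition (x, U) (y, V)"
        using charts_topological[OF x] charts_topological[OF y] charts_transition[OF x c(1)] by auto
      show "C_infinity_on (\<lambda>a. f (inv_into V y a)) (y ` ?W)"
        using smooth_fun_onD(1)[OF f c(1)] by (rule C_infinity_on_subset) blast
    qed (use oW in auto)
    moreover have "open (x ` ?W)" by (rule chart_open_image[OF x oW]) blast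
    ultimately show "\<exists>T. open T \<and> a \<in> T \<and> Ck_on k (\<lambda>a. f (inv_into U x a)) T"
      using p c(2) by (intro exI[of _ "x ` ?W"]) (auto simp: C_infinity_on_def)
  qed
qed

lemma smooth_near_chartE:
  assumes "(x, U) \<in> charts A" "p \<in> U" "smooth_near A p f"
  obtains W where "open W" "p \<in> W" "W \<subseteq> U" "smooth_fun_on A W f"
    "open (x ` W)" "C_infinity_on (\<lambda>a. f (inv_into U x a)) (x ` W)"
proof -
  obtain W where W: "p \<in> W" "smooth_fun_on A W f" using assms(3) by (auto simp: smooth_near_def)
  have o: "open (U \<inter> W)" using charts_open[OF assms(1)] smooth_fun_onD(2)[OF W(2)] by blast
  show ?thesis
    by (rule that[of "U \<inter> W"])
      (use o W assms smooth_fun_on_subset[OF W(2) o] chart_open_image[OF assms(1) o]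
        smooth_fun_on_rep[OF assms(1) W(2)] in auto)
qed

lemma smooth_near_cong:
  assumes "smooth_near A p f" "eventually (\<lambda>q. f q = g q) (nhds p)"
  shows "smooth_near A p g"
proof -
  obtain y V where c: "(y, V) \<in> A" "p \<in> V" by (rule atlas_chart_at)
  then have y: "(y, V) \<in> charts A" using atlas_subset_charts by blast
  obtain W where W: "open W" "p \<in> W" "W \<subseteq> V" "C_infinity_on (\<lambda>a. f (inv_into V y a)) (y ` W)"
    by (rule smooth_near_chartE[OF y c(2) assms(1)])
  obtain N where N: "open N" "p \<in> N" "\<And>q. q \<in> N \<Longrightarrow> f q = g q"
    using assms(2) unfolding eventually_nhds by blast
  have sub: "W \<inter> N \<subseteq> V" and o: "open (W \<inter> N)" using W N by blast+
  have "C_infinity_on (\<lambda>a. g (inv_into V y a)) (y ` (W \<inter> N))"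
  proof (rule C_infinity_on_cong)
    show "C_infinity_on (\<lambda>a. f (inv_into V y a)) (y ` (W \<inter> N))"
      using W(4) by (rule C_infinity_on_subset) blast
    show "open (y ` (W \<inter> N))" by (rule chart_open_image[OF y o sub])
    show "f (inv_into V y a) = g (inv_into V y a)" if "a \<in> y ` (W \<inter> N)" for a
      using that chart_inv[OF y] sub N(3) by auto
  qed
  from smooth_fun_on_chartI[OF y o sub this] show ?thesis by (rule smooth_nearI) (use W N in blast)
qed

lemma smooth_near_eventually:
  "smooth_near A p f \<Longrightarrow> eventually (\<lambda>q. smooth_near A q f) (nhds p)"
  unfolding smooth_near_def eventually_nhds smooth_fun_on_def by blast

lemma smooth_near_const: "smooth_near A p (\<lambda>q. c)"
  by (rule smooth_nearI[of A UNIV]) (auto simp: smooth_fun_on_def C_infinity_on_const)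

lemma smooth_near_binop:
  fixes F :: "real \<Rightarrow> real \<Rightarrow> real"
  assumes F: "\<And>(f :: real^'n \<Rightarrow> real) g S. open S \<Longrightarrow> C_infinity_on f S \<Longrightarrow> C_infinity_on g S
      \<Longrightarrow> C_infinity_on (\<lambda>a. F (f a) (g a)) S"
    and f: "smooth_near A p f" and g: "smooth_near A p g"
  shows "smooth_near A p (\<lambda>q. F (f q) (g q))"
proof -
  obtain y V where c: "(y, V) \<in> A" "p \<in> V" by (rule atlas_chart_at)
  then have y: "(y, V) \<in> charts A" using atlas_subset_charts by blast
  obtain W where W: "open W" "p \<in> W" "W \<subseteq> V" "C_infinity_on (\<lambda>a. f (inv_into V y a)) (y ` W)"
    by (rule smooth_near_chartE[OF y c(2) f])
  obtain N where N: "open N" "p \<in> N" "N \<subseteq> V" "C_infinity_on (\<lambda>a. g (inv_into V y a)) (y ` N)"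
    by (rule smooth_near_chartE[OF y c(2) g])
  have sub: "W \<inter> N \<subseteq> V" and o: "open (W \<inter> N)" using W N by blast+
  have "C_infinity_on (\<lambda>a. F (f (inv_into V y a)) (g (inv_into V y a))) (y ` (W \<inter> N))"
    by (rule F[OF chart_open_image[OF y o sub] C_infinity_on_subset[OF W(4)] C_infinity_on_subset[OF N(4)]])
      blast+
  from smooth_fun_on_chartI[OF y o sub this] show ?thesis by (rule smooth_nearI) (use W N in blast)
qed

lemma smooth_near_add:
  "smooth_near A p f \<Longrightarrow> smooth_near A p g \<Longrightarrow> smooth_near A p (\<lambda>q. f q + g q)"
  by (rule smooth_near_binop) (rule C_infinity_on_add)

lemma smooth_near_mult:
  "smooth_near A p f \<Longrightarrow> smooth_near A p g \<Longrightarrow> smooth_near A p (\<lambda>q. f q * g q)"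
  by (rule smooth_near_binop) (rule C_infinity_on_mult)

lemma smooth_near_sum:
  "finite I \<Longrightarrow> (\<And>b. b \<in> I \<Longrightarrow> smooth_near A p (f b)) \<Longrightarrow> smooth_near A p (\<lambda>q. \<Sum>b\<in>I. f b q)"
  by (induction I rule: finite_induct) (auto intro: smooth_near_const smooth_near_add)

section \<open>Partial derivatives in a chart\<close>

lemma chart_partial_cong:
  assumes x: "(x, U) \<in> charts A" and p: "p \<in> U" and eq: "eventually (\<lambda>q. f q = g q) (nhds p)"
  shows "chart_partial (x, U) i f p = chart_partial (x, U) i g p"
proof -
  obtain N where N: "open N" "p \<in> N" "\<And>q. q \<in> N \<Longrightarrow> f q = g q"
    using eq unfolding eventually_nhds by blast
  have o: "open (U \<inter> N)" using charts_open[OF x] N by blast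
  have "partial_deriv i (\<lambda>a. f (inv_into U x a)) (x p) = partial_deriv i (\<lambda>a. g (inv_into U x a)) (x p)"
    by (rule partial_deriv_cong[OF chart_open_image[OF x o]]) (use p N chart_inv[OF x] in auto)
  then show ?thesis by (simp add: chart_partial_def)
qed

lemma smooth_near_differentiable:
  assumes "(x, U) \<in> charts A" "p \<in> U" "smooth_near A p f"
  shows "(\<lambda>a. f (inv_into U x a)) differentiable at (x p)"
  by (rule smooth_near_chartE[OF assms]) (auto intro: C_infinity_on_differentiable)

lemma chart_partial_add:
  assumes "(x, U) \<in> charts A" "p \<in> U" "smooth_near A p f" "smooth_near A p g"
  shows "chart_partial (x, U) i (\<lambda>q. f q + g q) p = chart_partial (x, U) i f p + chart_partial (x, U) i g p"
  using partial_deriv_add smooth_near_differentiable assms by (fastforce simp: chart_partial_def)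

lemma chart_partial_const: "chart_partial c i (\<lambda>q. r) p = 0"
  by (simp add: chart_partial_def split: prod.split)

lemma chart_partial_mult:
  assumes "(x, U) \<in> charts A" "p \<in> U" "smooth_near A p f" "smooth_near A p g"
  shows "chart_partial (x, U) i (\<lambda>q. f q * g q) p =
    chart_partial (x, U) i f p * g p + f p * chart_partial (x, U) i g p"
  using partial_deriv_mult[OF smooth_near_differentiable[OF assms(1,2,3)]
      smooth_near_differentiable[OF assms(1,2,4)], of i]
  by (simp add: chart_partial_def chart_inv[OF assms(1,2)])

text \<open>
  Smoothness matters here beyond its own sake: a tangent vector applied to \<open>chart_partial (x, U) i f\<close>
  would return the dummy value \<open>0\<close> otherwise.
\<close>

lemma smooth_near_chart_partial:
  assumes x: "(x, U) \<in> charts A" and p: "p \<in> U" and f: "smooth_near A p f"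
  shows "smooth_near A p (chart_partial (x, U) i f)"
proof -
  obtain W where W: "open W" "p \<in> W" "W \<subseteq> U" "open (x ` W)"
    "C_infinity_on (\<lambda>a. f (inv_into U x a)) (x ` W)" by (rule smooth_near_chartE[OF x p f])
  have "C_infinity_on (\<lambda>a. chart_partial (x, U) i f (inv_into U x a)) (x ` W)"
    by (rule C_infinity_on_cong[OF W(4) _ C_infinity_on_partial_deriv[OF W(5), of i]])
      (use W chart_inv[OF x] in \<open>auto simp: chart_partial_def subset_iff\<close>)
  from smooth_fun_on_chartI[OF x W(1,3) this] show ?thesis by (rule smooth_nearI) (rule W(2))
qed

lemma coordinate_smooth:
  assumes x: "(x, U) \<in> charts A"
  shows "smooth_fun_on A U (\<lambda>q. x q $ b)"
proof (rule smooth_fun_on_chartI[OF x charts_open[OF x] order_refl])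
  show "C_infinity_on (\<lambda>a. x (inv_into U x a) $ b) (x ` U)"
    by (rule C_infinity_on_cong[OF chart_open_image[OF x charts_open[OF x] order_refl] _
          C_infinity_on_component[of b]])
      (use chart_inv[OF x] in auto)
qed

lemma chart_partial_coordinate:
  assumes x: "(x, U) \<in> charts A" and p: "p \<in> U"
  shows "chart_partial (x, U) i (\<lambda>q. x q $ b) p = (if i = b then 1 else 0)"
proof -
  have "partial_deriv i (\<lambda>a. x (inv_into U x a) $ b) (x p) = partial_deriv i (\<lambda>a. a $ b) (x p)"
    by (rule partial_deriv_cong[OF chart_open_image[OF x charts_open[OF x] order_refl]])
      (use p chart_inv[OF x] in auto)
  then show ?thesis by (simp add: chart_partial_def partial_deriv_component)
qed

lemma chart_partial_change_chart:
  assumes x: "(x, U) \<in> charts A" "p \<in> U" and y: "(y, V) \<in> charts A" "p \<in> V"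
    and f: "smooth_near A p f"
  shows "chart_partial (x, U) i f p =
    (\<Sum>b\<in>UNIV. chart_partial (x, U) i (\<lambda>q. y q $ b) p * chart_partial (y, V) b f p)"
proof -
  have o: "open (U \<inter> V)" using charts_open x y by blast
  have "chart_partial (x, U) i f p =
      partial_deriv i (\<lambda>a. (\<lambda>c. f (inv_into V y c)) (y (inv_into U x a))) (x p)"
    unfolding chart_partial_def prod.case
    by (rule partial_deriv_cong[OF chart_open_image[OF x(1) o]])
      (use x y chart_inv[OF x(1)] chart_inv[OF y(1)] in auto)
  also have "\<dots> = (\<Sum>b\<in>UNIV. partial_deriv i (\<lambda>a. y (inv_into U x a) $ b) (x p) *
      partial_deriv b (\<lambda>c. f (inv_into V y c)) (y (inv_into U x (x p))))"
  proof (rule partial_deriv_chain)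
    show "(\<lambda>a. y (inv_into U x a) $ b) differentiable at (x p)" for b
      by (rule smooth_near_differentiable[OF x smooth_nearI[OF coordinate_smooth[OF y(1)] y(2)]])
    show "(\<lambda>c. f (inv_into V y c)) differentiable at (y (inv_into U x (x p)))"
      using smooth_near_differentiable[OF y f] by (simp add: chart_inv[OF x])
  qed
  finally show ?thesis by (simp add: chart_partial_def chart_inv[OF x])
qed

lemma chart_partials_commute:
  assumes x: "(x, U) \<in> charts A" and p: "p \<in> U" and f: "smooth_near A p f"
  shows "chart_partial (x, U) i (chart_partial (x, U) j f) p =
    chart_partial (x, U) j (chart_partial (x, U) i f) p"
proof -
  obtain W where W: "open W" "p \<in> W" "W \<subseteq> U" "open (x ` W)"
    "C_infinity_on (\<lambda>a. f (inv_into U x a)) (x ` W)" by (rule smooth_near_chartE[OF x p f])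
  have 1: "chart_partial (x, U) k (chart_partial (x, U) l f) p =
    partial_deriv k (partial_deriv l (\<lambda>a. f (inv_into U x a))) (x p)" for k l
    unfolding chart_partial_def prod.case
    by (rule partial_deriv_cong[OF W(4)]) (use W chart_inv[OF x] in \<open>auto simp: subset_iff\<close>)
  have "Ck_on 2 (\<lambda>a. f (inv_into U x a)) (x ` W)" using W(5) by (simp add: C_infinity_on_def)
  from mixed_partials_commute[OF W(4) this, of "x p" i j] show ?thesis unfolding 1 using W by auto
qed

section \<open>Coordinate fields\<close>

lemma coord_field_smooth:
  "smooth_near A p f \<Longrightarrow> coord_field A c i p f = chart_partial c i f p"
  by (simp add: coord_field_def)

lemma tangent_spaceI:
  assumes "\<And>f g. smooth_near A p f \<Longrightarrow> smooth_near A p g \<Longrightarrow>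
      eventually (\<lambda>q. f q = g q) (nhds p) \<Longrightarrow> v f = v g"
    and "\<And>f g. smooth_near A p f \<Longrightarrow> smooth_near A p g \<Longrightarrow> v (\<lambda>q. f q + g q) = v f + v g"
    and "\<And>f g. smooth_near A p f \<Longrightarrow> smooth_near A p g \<Longrightarrow> v (\<lambda>q. f q * g q) = v f * g p + f p * v g"
    and "\<And>c f. smooth_near A p f \<Longrightarrow> v (\<lambda>q. c * f q) = c * v f"
    and "\<And>f. \<not> smooth_near A p f \<Longrightarrow> v f = 0"
  shows "v \<in> tangent_space A p"
  unfolding tangent_space_def mem_Collect_eq by (intro conjI allI impI assms)

lemma tangent_spaceD:
  assumes "v \<in> tangent_space A p"
  shows "smooth_near A p f \<Longrightarrow> smooth_near A p g \<Longrightarrow> eventually (\<lambda>q. f q = g q) (nhds p) \<Longrightarrow> v f = v g"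
    and "smooth_near A p f \<Longrightarrow> smooth_near A p g \<Longrightarrow> v (\<lambda>q. f q + g q) = v f + v g"
    and "smooth_near A p f \<Longrightarrow> smooth_near A p g \<Longrightarrow> v (\<lambda>q. f q * g q) = v f * g p + f p * v g"
    and "smooth_near A p f \<Longrightarrow> v (\<lambda>q. c * f q) = c * v f"
    and "\<not> smooth_near A p f \<Longrightarrow> v f = 0"
  using assms unfolding tangent_space_def mem_Collect_eq by meson+

lemma tangent_combination:
  assumes "u \<in> tangent_space A p" "v \<in> tangent_space A p"
  shows "(\<lambda>f. a * u f + b * v f) \<in> tangent_space A p"
proof (rule tangent_spaceI)
  show "a * u f + b * v f = a * u g + b * v g"
    if "smooth_near A p f" "smooth_near A p g" "eventually (\<lambda>q. f q = g q) (nhds p)" for f g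
    using tangent_spaceD(1)[OF assms(1) that] tangent_spaceD(1)[OF assms(2) that] by simp
qed (simp_all add: tangent_spaceD(2-5)[OF assms(1)] tangent_spaceD(2-5)[OF assms(2)] algebra_simps)

lemma tangent_zero: "(\<lambda>f. 0) \<in> tangent_space A p"
  by (simp add: tangent_space_def)

lemma tangent_scale: "u \<in> tangent_space A p \<Longrightarrow> (\<lambda>f. a * u f) \<in> tangent_space A p"
  using tangent_combination[of u p u a 0] by simp

lemma tangent_sum:
  "finite I \<Longrightarrow> (\<And>b. b \<in> I \<Longrightarrow> u b \<in> tangent_space A p) \<Longrightarrow>
    (\<lambda>f. \<Sum>b\<in>I. c b * u b f) \<in> tangent_space A p"
proof (induction I rule: finite_induct)
  case empty then show ?case by (simp add: tangent_zero)
next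
  case (insert b I)
  then show ?case using tangent_combination[of "u b" p "\<lambda>f. \<Sum>b\<in>I. c b * u b f" "c b" 1] by simp
qed

lemma coord_field_tangent:
  assumes x: "(x, U) \<in> charts A" and p: "p \<in> U"
  shows "coord_field A (x, U) i p \<in> tangent_space A p"
proof (rule tangent_spaceI)
  show "coord_field A (x, U) i p f = coord_field A (x, U) i p g"
    if "smooth_near A p f" "smooth_near A p g" "eventually (\<lambda>q. f q = g q) (nhds p)" for f g
    using chart_partial_cong[OF x p that(3)] that(1,2) by (simp add: coord_field_smooth)
  show "coord_field A (x, U) i p (\<lambda>q. f q + g q) = coord_field A (x, U) i p f + coord_field A (x, U) i p g"
    "coord_field A (x, U) i p (\<lambda>q. f q * g q) = coord_field A (x, U) i p f * g p + f p * coord_field A (x, U) i p g"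
    if "smooth_near A p f" "smooth_near A p g" for f g
    using that chart_partial_add[OF x p] chart_partial_mult[OF x p]
    by (simp_all add: coord_field_smooth smooth_near_add smooth_near_mult)
  show "coord_field A (x, U) i p (\<lambda>q. c * f q) = c * coord_field A (x, U) i p f"
    if "smooth_near A p f" for f c
    using that chart_partial_mult[OF x p smooth_near_const that, of i c]
    by (simp add: coord_field_smooth smooth_near_mult smooth_near_const chart_partial_const)
qed (simp add: coord_field_def)

text \<open>
  An identity of functionals: on functions that are not smooth near \<open>p\<close> both sides are \<open>0\<close>.
\<close>

lemma coord_field_change_chart:
  assumes x: "(x, U) \<in> charts A" "p \<in> U" and y: "(y, V) \<in> charts A" "p \<in> V"
  shows "coord_field A (x, U) i p =
    (\<lambda>f. \<Sum>b\<in>UNIV. chart_partial (x, U) i (\<lambda>q. y q $ b) p * coord_field A (y, V) b p f)"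
  using chart_partial_change_chart[OF x y] by (auto simp: coord_field_def fun_eq_iff)

text \<open>
  The coordinate field is multiplied by a bump function \<open>\<phi>\<close> with support in a closed ball \<open>B \<subseteq> x(U)\<close>.
  The subset \<open>K\<close> of \<open>U\<close> that corresponds to \<open>B\<close> is compact, hence closed, because the manifold is
  Hausdorff. So the extension by \<open>0\<close> is smooth: \<open>U\<close> and the complement of \<open>K\<close> form an open cover, and
  the field vanishes on the latter.
\<close>

lemma coord_field_extension:
  assumes x: "(x, U) \<in> charts A" and p: "p \<in> U"
  obtains X where "X \<in> vector_fields A" "eventually (\<lambda>q. X q = coord_field A (x, U) i q) (nhds p)"
proof -
  have oxU: "open (x ` U)" by (rule chart_open_image[OF x charts_open[OF x] order_refl])
  then obtain r where r: "r > 0" "cball (x p) r \<subseteq> x ` U"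
    using p open_contains_cball by blast
  obtain \<phi> :: "real^'n \<Rightarrow> real" where \<phi>: "C_infinity_on \<phi> UNIV"
    "\<And>a. dist a (x p) < r / 2 \<Longrightarrow> \<phi> a = 1" "\<And>a. dist a (x p) \<ge> r \<Longrightarrow> \<phi> a = 0"
    using smooth_bump[OF r(1)] by metis
  define X where "X = (\<lambda>q f. if q \<in> U then \<phi> (x q) * coord_field A (x, U) i q f else 0)"
  define K where "K = inv_into U x ` cball (x p) r"
  have hom: "homeomorphism U (x ` U) x (inv_into U x)"
    using charts_topological[OF x] by (simp add: topological_chart_def)
  have "compact K" unfolding K_def
    by (rule compact_continuous_image)
      (use hom r(2) in \<open>auto simp: homeomorphism_def intro: continuous_on_subset\<close>)
  then have K: "closed K" by (rule compact_imp_closed)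
  have "K \<subseteq> U" unfolding K_def using r(2) chart_inv[OF x] by (auto simp: subset_iff)
  have X0: "X q = (\<lambda>f. 0)" if "q \<notin> K" for q
  proof (cases "q \<in> U")
    case True
    have "x q \<notin> cball (x p) r"
      using that chart_inv[OF x True] unfolding K_def by (metis imageI)
    then have "\<phi> (x q) = 0" by (intro \<phi>(3)) (simp add: dist_commute)
    then show ?thesis by (simp add: X_def fun_eq_iff)
  qed (simp add: X_def)
  have "X q \<in> tangent_space A q" for q
    using tangent_scale[OF coord_field_tangent[OF x]] by (cases "q \<in> U") (auto simp: X_def tangent_zero)
  moreover have "smooth_fun_on A W (\<lambda>q. X q f)" if f: "smooth_fun_on A W f" for W f
  proof (rule smooth_fun_on_local)
    show W: "open W" using f by (rule smooth_fun_onD)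
    fix q assume q: "q \<in> W"
    show "smooth_near A q (\<lambda>q. X q f)"
    proof (cases "q \<in> U")
      case True
      have "C_infinity_on (\<lambda>a. \<phi> (x (inv_into U x a))) (x ` U)"
        by (rule C_infinity_on_cong[OF oxU _ C_infinity_on_subset[OF \<phi>(1)]])
          (use chart_inv[OF x] in auto)
      from smooth_fun_on_chartI[OF x charts_open[OF x] order_refl, of "\<lambda>q. \<phi> (x q)", OF this]
      have "smooth_near A q (\<lambda>q. \<phi> (x q))" using True by (rule smooth_nearI)
      then have "smooth_near A q (\<lambda>q. \<phi> (x q) * chart_partial (x, U) i f q)"
        by (rule smooth_near_mult) (rule smooth_near_chart_partial[OF x True smooth_nearI[OF f q]])
      moreover have "eventually (\<lambda>q. q \<in> U \<inter> W) (nhds q)"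
        using W charts_open[OF x] True q by (intro eventually_nhds_in_open) auto
      then have "eventually (\<lambda>q. \<phi> (x q) * chart_partial (x, U) i f q = X q f) (nhds q)"
        by eventually_elim (use smooth_nearI[OF f] in \<open>simp add: X_def coord_field_def\<close>)
      ultimately show ?thesis by (rule smooth_near_cong)
    next
      case False
      then have "eventually (\<lambda>q. q \<in> - K) (nhds q)"
        using K \<open>K \<subseteq> U\<close> by (intro eventually_nhds_in_open) auto
      then have "eventually (\<lambda>q. 0 = X q f) (nhds q)" by eventually_elim (simp add: X0)
      with smooth_near_const show ?thesis by (rule smooth_near_cong)
    qed
  qed
  ultimately have "X \<in> vector_fields A" by (simp add: vector_fields_def)
  moreover have "eventually (\<lambda>q. X q = coord_field A (x, U) i q) (nhds p)"
  proof -
    have "isCont x p"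
      using hom p charts_open[OF x] by (auto simp: homeomorphism_def continuous_on_eq_continuous_at)
    then have "eventually (\<lambda>q. dist (x q) (x p) < r / 2) (nhds p)"
      using r(1) by (intro tendstoD) (auto simp: isCont_def tendsto_at_iff_tendsto_nhds)
    moreover have "eventually (\<lambda>q. q \<in> U) (nhds p)"
      using p charts_open[OF x] by (intro eventually_nhds_in_open)
    ultimately show ?thesis by eventually_elim (simp add: X_def \<phi>(2))
  qed
  ultimately show ?thesis by (rule that)
qed

section \<open>Two-tensors in coordinates\<close>

lemma tensor_combination:
  assumes "smooth_two_tensor A \<omega>" "u \<in> tangent_space A p" "v \<in> tangent_space A p" "w \<in> tangent_space A p"
  shows "\<omega> p (\<lambda>f. a * u f + b * v f) w = a * \<omega> p u w + b * \<omega> p v w"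
    and "\<omega> p w (\<lambda>f. a * u f + b * v f) = a * \<omega> p w u + b * \<omega> p w v"
  using assms unfolding smooth_two_tensor_def by blast+

lemma tensor_zero:
  assumes "smooth_two_tensor A \<omega>" "w \<in> tangent_space A p"
  shows "\<omega> p (\<lambda>f. 0) w = 0" and "\<omega> p w (\<lambda>f. 0) = 0"
  using tensor_combination[OF assms(1) tangent_zero tangent_zero assms(2), of 0 0] by simp_all

lemma tensor_sum:
  assumes \<omega>: "smooth_two_tensor A \<omega>" and w: "w \<in> tangent_space A p"
    and I: "finite I" "\<And>b. b \<in> I \<Longrightarrow> u b \<in> tangent_space A p"
  shows "\<omega> p (\<lambda>f. \<Sum>b\<in>I. c b * u b f) w = (\<Sum>b\<in>I. c b * \<omega> p (u b) w)"
    and "\<omega> p w (\<lambda>f. \<Sum>b\<in>I. c b * u b f) = (\<Sum>b\<in>I. c b * \<omega> p w (u b))"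
  using I
proof (induction I rule: finite_induct)
  case empty
  case 1 then show ?case by (simp add: tensor_zero[OF \<omega> w])
  case 2 then show ?case by (simp add: tensor_zero[OF \<omega> w])
next
  case (insert b I)
  have T: "(\<lambda>f. \<Sum>b\<in>I. c b * u b f) \<in> tangent_space A p" "u b \<in> tangent_space A p"
    if "\<And>d. d \<in> insert b I \<Longrightarrow> u d \<in> tangent_space A p"
    using that insert.hyps by (auto intro: tangent_sum)
  case 1 then show ?case
    using insert tensor_combination(1)[OF \<omega> T(2,1) w, of "c b" 1] by simp
  case 2 then show ?case
    using insert tensor_combination(2)[OF \<omega> T(2,1) w, of "c b" 1] by simp
qed

text \<open>
  Near \<open>p\<close>, choose a chart \<open>(y, V)\<close> of the given atlas. With \<open>J\<^sub>i\<^sub>b = \<partial>y\<^sup>b/\<partial>x\<^sup>i\<close> and \<open>h\<close> the components of \<open>\<omega>\<close> in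
  \<open>(y, V)\<close>, which are smooth by assumption, the component in \<open>(x, U)\<close> is \<open>\<Sum>\<^sub>a\<^sub>b J\<^sub>i\<^sub>a J\<^sub>j\<^sub>b h\<^sub>a\<^sub>b\<close>.
\<close>

lemma tensor_components_smooth:
  assumes \<omega>: "smooth_two_tensor A \<omega>" and x: "(x, U) \<in> charts A" and p: "p \<in> U"
  shows "smooth_near A p (\<lambda>q. \<omega> q (coord_field A (x, U) i q) (coord_field A (x, U) j q))"
proof -
  obtain y V where c: "(y, V) \<in> A" "p \<in> V" by (rule atlas_chart_at)
  then have y: "(y, V) \<in> charts A" using atlas_subset_charts by blast
  let ?J = "\<lambda>i b. chart_partial (x, U) i (\<lambda>q. y q $ b)"
  let ?h = "\<lambda>a b q. \<omega> q (coord_field A (y, V) a q) (coord_field A (y, V) b q)"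
  have J: "smooth_near A p (?J i b)" for i b
    by (rule smooth_near_chart_partial[OF x p smooth_nearI[OF coordinate_smooth[OF y] c(2)]])
  have h: "smooth_near A p (?h a b)" for a b
    by (rule smooth_nearI[OF _ c(2)]) (use \<omega> c(1) in \<open>auto simp: smooth_two_tensor_def\<close>)
  have "smooth_near A p (\<lambda>q. \<Sum>a\<in>UNIV. ?J i a q * (\<Sum>b\<in>UNIV. ?J j b q * ?h a b q))"
    by (intro smooth_near_sum smooth_near_mult finite J h)
  moreover have "eventually (\<lambda>q. q \<in> U \<inter> V) (nhds p)"
    using charts_open[OF x] charts_open[OF y] p c(2) by (intro eventually_nhds_in_open) auto
  then have "eventually (\<lambda>q. (\<Sum>a\<in>UNIV. ?J i a q * (\<Sum>b\<in>UNIV. ?J j b q * ?h a b q)) =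
      \<omega> q (coord_field A (x, U) i q) (coord_field A (x, U) j q)) (nhds p)"
  proof eventually_elim
    case (elim q)
    then have q: "q \<in> U" "q \<in> V" by auto
    note T = coord_field_tangent[OF x q(1)] coord_field_tangent[OF y q(2)]
    have inner: "\<omega> q (coord_field A (y, V) a q) (coord_field A (x, U) j q) =
        (\<Sum>b\<in>UNIV. ?J j b q * ?h a b q)" for a
      by (subst coord_field_change_chart[OF x q(1) y q(2), of j])
        (rule tensor_sum(2)[OF \<omega> T(2) finite T(2)])
    have "\<omega> q (coord_field A (x, U) i q) (coord_field A (x, U) j q) =
        (\<Sum>a\<in>UNIV. ?J i a q * \<omega> q (coord_field A (y, V) a q) (coord_field A (x, U) j q))"
      by (subst coord_field_change_chart[OF x q(1) y q(2), of i])
        (rule tensor_sum(1)[OF \<omega> T(1) finite T(2)])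
    then show ?case by (simp only: inner)
  qed
  ultimately show ?thesis by (rule smooth_near_cong)
qed

lemma component_eq_tensor_coord_fields:
  assumes x: "(x, U) \<in> charts A" and p: "p \<in> U" and g: "has_components A \<omega> (x, U) g"
  shows "\<omega> p (coord_field A (x, U) i p) (coord_field A (x, U) j p) = g i j p"
proof -
  have dx: "coord_field A (x, U) k p (\<lambda>q. x q $ b) = (if k = b then 1 else 0)" for k b
    using coord_field_smooth[OF smooth_nearI[OF coordinate_smooth[OF x] p]]
      chart_partial_coordinate[OF x p] by simp
  have "\<omega> p (coord_field A (x, U) i p) (coord_field A (x, U) j p) =
      (\<Sum>a\<in>UNIV. \<Sum>b\<in>UNIV. g a b p * (if i = a then 1 else 0) * (if j = b then 1 else 0))"
    using g p coord_field_tangent[OF x p] by (simp add: has_components_def dx)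
  also have "\<dots> = (\<Sum>a\<in>UNIV. \<Sum>b\<in>UNIV. if j = b then (if i = a then g a b p else 0) else 0)"
    by (intro sum.cong) auto
  also have "\<dots> = g i j p" by simp
  finally show ?thesis .
qed

section \<open>The Leibniz coboundary on coordinate fields\<close>

text \<open>
  Brackets are computed with global fields, as the coordinate fields themselves need not be in
  \<open>vector_fields A\<close>. That \<open>X\<close> and \<open>Y\<close> agree with coordinate fields near \<open>p\<close>, not just at \<open>p\<close>, is essential,
  since the bracket differentiates the functions \<open>q \<mapsto> X q f\<close> and \<open>q \<mapsto> Y q f\<close>.
\<close>

lemma lie_bracket_coord_fields:
  assumes x: "(x, U) \<in> charts A" and p: "p \<in> U"
    and X: "X \<in> vector_fields A" "eventually (\<lambda>q. X q = coord_field A (x, U) i q) (nhds p)"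
    and Y: "Y \<in> vector_fields A" "eventually (\<lambda>q. Y q = coord_field A (x, U) j q) (nhds p)"
  shows "lie_bracket A X Y p = (\<lambda>f. 0)"
proof
  fix f
  have twice: "Z' p (\<lambda>q. Z q f) = chart_partial (x, U) k (chart_partial (x, U) l f) p"
    if f: "smooth_near A p f" and Z': "Z' p = coord_field A (x, U) k p"
      and Z: "eventually (\<lambda>q. Z q = coord_field A (x, U) l q) (nhds p)" for Z Z' k l
  proof -
    have eq: "eventually (\<lambda>q. chart_partial (x, U) l f q = Z q f) (nhds p)"
      using Z smooth_near_eventually[OF f] by eventually_elim (simp add: coord_field_smooth)
    have "smooth_near A p (\<lambda>q. Z q f)"
      by (rule smooth_near_cong[OF smooth_near_chart_partial[OF x p f] eq])
    then have "Z' p (\<lambda>q. Z q f) = chart_partial (x, U) k (\<lambda>q. Z q f) p"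
      by (simp add: Z' coord_field_smooth)
    then show ?thesis using chart_partial_cong[OF x p eq] by simp
  qed
  show "lie_bracket A X Y p f = 0"
  proof (cases "smooth_near A p f")
    case True
    then show ?thesis
      using twice[where Z' = X and Z = Y, OF True eventually_nhds_x_imp_x[OF X(2)] Y(2)]
        twice[where Z' = Y and Z = X, OF True eventually_nhds_x_imp_x[OF Y(2)] X(2)]
        chart_partials_commute[OF x p True, of i j]
      by (simp add: lie_bracket_def)
  qed (simp add: lie_bracket_def)
qed

lemma coord_derivative_of_component:
  assumes \<omega>: "smooth_two_tensor A \<omega>" and x: "(x, U) \<in> charts A" and p: "p \<in> U"
    and g: "has_components A \<omega> (x, U) g"
    and Y: "eventually (\<lambda>q. Y q = coord_field A (x, U) j q) (nhds p)"
    and Z: "eventually (\<lambda>q. Z q = coord_field A (x, U) k q) (nhds p)"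
  shows "coord_field A (x, U) i p (tensor_app \<omega> Y Z) = chart_partial (x, U) i (g j k) p"
proof -
  have U: "eventually (\<lambda>q. q \<in> U) (nhds p)"
    using p charts_open[OF x] by (intro eventually_nhds_in_open)
  have 1: "eventually (\<lambda>q. \<omega> q (coord_field A (x, U) j q) (coord_field A (x, U) k q) = tensor_app \<omega> Y Z q) (nhds p)"
    using Y Z by eventually_elim (simp add: tensor_app_def)
  have 2: "eventually (\<lambda>q. tensor_app \<omega> Y Z q = g j k q) (nhds p)"
    using 1 U by eventually_elim (simp add: component_eq_tensor_coord_fields[OF x _ g])
  show ?thesis
    using coord_field_smooth[OF smooth_near_cong[OF tensor_components_smooth[OF \<omega> x p] 1]]
      chart_partial_cong[OF x p 2] by simp
qed

lemma leibniz_d_coord_fields: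
  assumes \<omega>: "smooth_two_tensor A \<omega>" and x: "(x, U) \<in> charts A" and p: "p \<in> U"
    and g: "has_components A \<omega> (x, U) g"
    and X: "X \<in> vector_fields A" "eventually (\<lambda>q. X q = coord_field A (x, U) i q) (nhds p)"
    and Y: "Y \<in> vector_fields A" "eventually (\<lambda>q. Y q = coord_field A (x, U) l q) (nhds p)"
    and Z: "Z \<in> vector_fields A" "eventually (\<lambda>q. Z q = coord_field A (x, U) j q) (nhds p)"
  shows "leibniz_d A \<omega> X Y Z p = chart_partial (x, U) i (g l j) p
    - chart_partial (x, U) l (g i j) p + chart_partial (x, U) j (g i l) p"
proof -
  note XYZ = eventually_nhds_x_imp_x[OF X(2)] eventually_nhds_x_imp_x[OF Y(2)]
    eventually_nhds_x_imp_x[OF Z(2)]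
  note br = lie_bracket_coord_fields[OF x p]
  show ?thesis
    using coord_derivative_of_component[OF \<omega> x p g] X(2) Y(2) Z(2)
      tensor_zero[OF \<omega> coord_field_tangent[OF x p]]
    by (simp add: leibniz_d_def tensor_app_def[of _ "lie_bracket A _ _"]
        tensor_app_def[of _ _ "lie_bracket A _ _"] XYZ br[OF X Y] br[OF X Z] br[OF Y Z])
qed

lemma leibniz_d_local_coord_fields:
  assumes \<omega>: "smooth_two_tensor A \<omega>" and x: "(x, U) \<in> charts A" and p: "p \<in> U"
    and g: "has_components A \<omega> (x, U) g"
  shows "leibniz_d_local A \<omega> (coord_field A (x, U) i) (coord_field A (x, U) l) (coord_field A (x, U) j) p
    = chart_partial (x, U) i (g l j) p - chart_partial (x, U) l (g i j) p
      + chart_partial (x, U) j (g i l) p" (is "_ = ?c")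
  unfolding leibniz_d_local_def
proof (rule the_equality)
  obtain X where X: "X \<in> vector_fields A" "eventually (\<lambda>q. X q = coord_field A (x, U) i q) (nhds p)"
    by (rule coord_field_extension[OF x p])
  obtain Y where Y: "Y \<in> vector_fields A" "eventually (\<lambda>q. Y q = coord_field A (x, U) l q) (nhds p)"
    by (rule coord_field_extension[OF x p])
  obtain Z where Z: "Z \<in> vector_fields A" "eventually (\<lambda>q. Z q = coord_field A (x, U) j q) (nhds p)"
    by (rule coord_field_extension[OF x p])
  have "eventually (\<lambda>q. X q = coord_field A (x, U) i q \<and> Y q = coord_field A (x, U) l q
      \<and> Z q = coord_field A (x, U) j q) (nhds p)"
    by (intro eventually_conj X Y Z)
  then show "\<exists>X'\<in>vector_fields A. \<exists>Y'\<in>vector_fields A. \<exists>Z'\<in>vector_fields A.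
      eventually (\<lambda>q. X' q = coord_field A (x, U) i q \<and> Y' q = coord_field A (x, U) l q
        \<and> Z' q = coord_field A (x, U) j q) (nhds p) \<and> ?c = leibniz_d A \<omega> X' Y' Z' p"
    using leibniz_d_coord_fields[OF \<omega> x p g X Y Z, symmetric] X(1) Y(1) Z(1) by blast
next
  fix c
  assume "\<exists>X'\<in>vector_fields A. \<exists>Y'\<in>vector_fields A. \<exists>Z'\<in>vector_fields A.
      eventually (\<lambda>q. X' q = coord_field A (x, U) i q \<and> Y' q = coord_field A (x, U) l q
        \<and> Z' q = coord_field A (x, U) j q) (nhds p) \<and> c = leibniz_d A \<omega> X' Y' Z' p"
  then show "c = ?c"
    using leibniz_d_coord_fields[OF \<omega> x p g] by (auto simp: eventually_conj_iff)
qed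

section \<open>The Leibniz coboundary and the Levi-Civita connection\<close>

text \<open>
  Compatibility and torsion turn \<open>d\<omega>(X \<otimes> Y \<otimes> Z)\<close> into
  \<open>\<langle>\<nabla>\<^sub>X Y, Z\<rangle> + \<langle>Y, \<nabla>\<^sub>X Z\<rangle> - \<langle>\<nabla>\<^sub>Y X, Z\<rangle> - \<langle>X, \<nabla>\<^sub>Y Z\<rangle> + \<langle>\<nabla>\<^sub>Z X, Y\<rangle> + \<langle>X, \<nabla>\<^sub>Z Y\<rangle>\<close>
  \<open>- \<langle>\<nabla>\<^sub>X Y, Z\<rangle> + \<langle>\<nabla>\<^sub>Y X, Z\<rangle> + \<langle>\<nabla>\<^sub>X Z, Y\<rangle> - \<langle>\<nabla>\<^sub>Z X, Y\<rangle> + \<langle>X, \<nabla>\<^sub>Y Z\<rangle> - \<langle>X, \<nabla>\<^sub>Z Y\<rangle>\<close>.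
  Everything cancels except \<open>\<langle>Y, \<nabla>\<^sub>X Z\<rangle> + \<langle>\<nabla>\<^sub>X Z, Y\<rangle>\<close>, and these two agree by symmetry.
\<close>

lemma leibniz_d_levi_civita:
  assumes \<omega>: "riemannian_metric A \<omega>" and D: "levi_civita_connection A \<omega> D"
    and XYZ: "X \<in> vector_fields A" "Y \<in> vector_fields A" "Z \<in> vector_fields A"
  shows "leibniz_d A \<omega> X Y Z p = 2 * tensor_app \<omega> Y (D X Z) p"
proof -
  have T: "V p \<in> tangent_space A p" if "V \<in> vector_fields A" for V
    using that by (simp add: vector_fields_def)
  have D_field: "D V W \<in> vector_fields A" if "V \<in> vector_fields A" "W \<in> vector_fields A" for V W
    using D that by (simp add: levi_civita_connection_def affine_connection_def)
  have sym: "\<omega> p (V p) (W p) = \<omega> p (W p) (V p)" if "V \<in> vector_fields A" "W \<in> vector_fields A" for V W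
    using \<omega> T that by (simp add: riemannian_metric_def)
  have \<omega>2: "smooth_two_tensor A \<omega>" using \<omega> by (simp add: riemannian_metric_def)
  have compat: "S p (tensor_app \<omega> V W) = \<omega> p (D S V p) (W p) + \<omega> p (V p) (D S W p)"
    if "S \<in> vector_fields A" "V \<in> vector_fields A" "W \<in> vector_fields A" for S V W
    using D that by (simp add: levi_civita_connection_def metric_compatible_def tensor_app_def)
  have torsion: "lie_bracket A V W p = (\<lambda>f. 1 * D V W p f + - 1 * D W V p f)"
    if "V \<in> vector_fields A" "W \<in> vector_fields A" for V W
  proof -
    have "lie_bracket A V W = (\<lambda>p f. D V W p f - D W V p f)"
      using D that by (simp add: levi_civita_connection_def torsion_free_def)
    then show ?thesis by simp
  qed
  have bracket: "tensor_app \<omega> (lie_bracket A V W) S p = \<omega> p (D V W p) (S p) - \<omega> p (D W V p) (S p)"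
    "tensor_app \<omega> S (lie_bracket A V W) p = \<omega> p (S p) (D V W p) - \<omega> p (S p) (D W V p)"
    if "V \<in> vector_fields A" "W \<in> vector_fields A" "S \<in> vector_fields A" for V W S
    unfolding tensor_app_def torsion[OF that(1,2)]
    using tensor_combination[OF \<omega>2 T[OF D_field[OF that(1,2)]] T[OF D_field[OF that(2,1)]] T[OF that(3)], of 1 "- 1"]
    by simp_all
  show ?thesis
    unfolding leibniz_d_def tensor_app_def[of \<omega> Y "D X Z"]
    using sym[OF D_field[OF XYZ(1,3)] XYZ(2)]
    by (simp add: compat bracket XYZ)
qed

end

theorem lemma3p3:
  fixes A :: "('a::t2_space, 'n::finite) chart set"
    and \<omega> :: "'a tensor2"
    and nabla :: "'a vfield \<Rightarrow> 'a vfield \<Rightarrow> 'a vfield"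
  assumes "smooth_atlas A"
    and "riemannian_metric A \<omega>"
    and "levi_civita_connection A \<omega> nabla"
  shows
    "(\<forall>(x, U)\<in>charts A. \<forall>g.
        has_components A \<omega> (x, U) g \<longrightarrow> (\<forall>a b. \<forall>p\<in>U. g a b p = g b a p) \<longrightarrow>
        (\<forall>p\<in>U. \<forall>i l j.
           leibniz_d_local A \<omega> (coord_field A (x, U) i) (coord_field A (x, U) l)
             (coord_field A (x, U) j) p
           = 2 * christoffel_first (x, U) g i j l p))
     \<and> (\<forall>X\<in>vector_fields A. \<forall>Y\<in>vector_fields A. \<forall>Z\<in>vector_fields A. \<forall>p.
           leibniz_d A \<omega> X Y Z p = 2 * tensor_app \<omega> Y (nabla X Z) p)"
proof -
  interpret manifold A using assms(1) by unfold_locales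
  have \<omega>: "smooth_two_tensor A \<omega>" using assms(2) by (simp add: riemannian_metric_def)
  have "leibniz_d_local A \<omega> (coord_field A (x, U) i) (coord_field A (x, U) l)
      (coord_field A (x, U) j) p = 2 * christoffel_first (x, U) g i j l p"
    if x: "(x, U) \<in> charts A" and g: "has_components A \<omega> (x, U) g"
      and sym: "\<forall>a b. \<forall>p\<in>U. g a b p = g b a p" and p: "p \<in> U" for x U g p i l j
  proof -
    have "eventually (\<lambda>q. q \<in> U) (nhds p)"
      using p charts_open[OF x] by (intro eventually_nhds_in_open)
    then have "eventually (\<lambda>q. g l j q = g j l q) (nhds p)"
      by eventually_elim (use sym in blast)
    from chart_partial_cong[OF x p this, of i] show ?thesis
      by (simp add: leibniz_d_local_coord_fields[OF \<omega> x p g] christoffel_first_def)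
  qed
  then show ?thesis using leibniz_d_levi_civita[OF assms(2,3)] by blast
qed

end
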